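(* Let $X$ be a (real) vector space with a semi-norm $\|\cdot\|_X$, let $T>0$, $\omega\in\mathbb{R}$, $L\ge 1$, and let $C\subseteq X$. Let $\{T_t\}_{t=0}^{T}$ be a family of mappings $T_t: C\times L^1(0,T;X)\to C$ with $T_0(u_0,f)=u_0$ for all $(u_0,f)$, such that: (i) for all $0\le s\le t\le T$, $u_0,\hat u_0\in C$ and $f,\hat f\in L^1(0,T;X)$, $$e^{-\omega t}\|T_t(u_0,f)-T_t(\hat u_0,\hat f)\|_X\le L e^{-\omega s}\|T_s(u_0,f)-T_s(\hat u_0,\hat f)\|_X+L\int_s^t e^{-\omega r}\|f(r)-\hat f(r)\|_X\,dr;$$ (ii) for all $u_0\in C$, $f\in L^1(0,T;X)$, $\lambda>0$ and $t\in[0,T]$ with $\lambda t\le T$, $$\lambda^{-1}T_{\lambda t}(u_0,f)=T_t(\lambda^{-1}u_0,f(\lambda\,\cdot));$$ (iii) $T_t(0,0)=0$ for all $t$. Then for every $u_0\in C$, $f\in L^1(0,T;X)$, $t\in(0,T]$ and $h>0$ with $t+h\le T$, $$\|T_{t+h}(u_0,f)-T_t(u_0,f)\|_X\le \frac{h}{t}\,L\,e^{\omega t}\left[2\|u_0\|_X+\Big(1+\frac ht\Big)\int_0^t e^{-\omega s}\left\|\frac{f(s+\frac ht s)-f(s)}{\frac ht}\right\|_X ds+\int_0^t e^{-\omega s}\|f(s)\|_X\,ds\right].$$ In particular, setting $$V(f,t):=\limsup_{\xi\to0}\int_0^t e^{-\omega s}\left\|\frac{f(s+\xi s)-f(s)}{\xi}\right\|_X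 ds,$$ one has for every $t\in(0,T)$, $u_0\in C$, $f\in L^1(0,T;X)$, $$\limsup_{h\to0+}\left\|\frac{T_{t+h}(u_0,f)-T_t(u_0,f)}{h}\right\|_X\le\frac{Le^{\omega t}}{t}\left[2\|u_0\|_X+V(f,t)+\int_0^te^{-\omega s}\|f(s)\|_X\,ds\right],$$ and if $f$ is locally absolutely continuous and differentiable a.e. on $(0,T)$, then $$\limsup_{h\to0+}\left\|\frac{T_{t+h}(u_0,f)-T_t(u_0,f)}{h}\right\|_X\le\frac{Le^{\omega t}}{t}\left[2\|u_0\|_X+\int_0^te^{-\omega s}s\|f'(s)\|_X\,ds+\int_0^te^{-\omega s}\|f(s)\|_X\,ds\right].$$ Moreover, if the right-hand derivative $\frac{d}{dt_+}T_t(u_0,f)$ exists in $X$ at $t\in(0,T)$, then $$\left\|\frac{d}{dt_+}T_t(u_0,f)\right\|_X\le\frac{Le^{\omega t}}{t}\left[2\|u_0\|_X+V(f,t)+\int_0^te^{-\omega s}\|f(s)\|_X\,ds\right].$$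
   Context: Implicitly in the hypotheses, $0\in C$ and $\lambda^{-1}u_0\in C$ for all $u_0\in C$, $\lambda>0$. Functions $f\in L^1(0,T;X)$ are extended by $0$ outside $(0,T)$ when an expression such as $f(\lambda\,\cdot)$ with $\lambda>1$ is considered as an element of $L^1(0,T;X)$. The right-hand derivative is $\frac{d}{dt_+}T_t(u_0,f)=\lim_{h\to0+}\frac{T_{t+h}(u_0,f)-T_t(u_0,f)}{h}$ in $X$. *)

theory Defs
  imports "HOL-Analysis.Analysis"
begin

definition is_seminorm :: "('a::real_vector \<Rightarrow> real) \<Rightarrow> bool" where
  "is_seminorm p \<longleftrightarrow>
     (\<forall>x. 0 \<le> p x) \<and> (\<forall>c x. p (c *\<^sub>R x) = \<bar>c\<bar> * p x) \<and> (\<forall>x y. p (x + y) \<le> p x + p y)"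

(* Bochner's notion of strong measurability, with convergence measured by the seminorm p
   (the library's version requires a normed space). *)
definition strongly_measurable ::
  "('a::real_vector \<Rightarrow> real) \<Rightarrow> 'b measure \<Rightarrow> ('b \<Rightarrow> 'a) \<Rightarrow> bool" where
  "strongly_measurable p M f \<longleftrightarrow>
     (\<exists>s. (\<forall>n::nat. simple_function M (s n)) \<and>
          (AE x in M. (\<lambda>n. p (s n x - f x)) \<longlonglongrightarrow> 0))"

(* Representatives of the elements of L^1(0,T;X).  They are functions on the whole real line,
   but their values outside (0,T) are arbitrary and play no role. *)
definition L1 :: "('a::real_vector \<Rightarrow> real) \<Rightarrow> real \<Rightarrow> (real \<Rightarrow> 'a) set" where
  "L1 p T = {f. strongly_measurable p (lebesgue_on {0<..<T}) f \<and>
                (\<integral>\<^sup>+x. ennreal (p (f x)) \<partial>(lebesgue_on {0<..<T})) < \<infinity>}"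

definition zero_ext :: "real \<Rightarrow> (real \<Rightarrow> 'a::real_vector) \<Rightarrow> real \<Rightarrow> 'a" where
  "zero_ext T f s = (if s \<in> {0<..<T} then f s else 0)"

(* D is a derivative of f at t with respect to p; it is unique only up to vectors of seminorm 0.
   The filter F is "at 0" for the two-sided and "at_right 0" for the right-hand derivative. *)
definition has_seminorm_derivative ::
  "('a::real_vector \<Rightarrow> real) \<Rightarrow> (real \<Rightarrow> 'a) \<Rightarrow> 'a \<Rightarrow> real \<Rightarrow> real filter \<Rightarrow> bool" where
  "has_seminorm_derivative p f D t F \<longleftrightarrow>
     ((\<lambda>h. p ((f (t + h) - f t) /\<^sub>R h - D)) \<longlongrightarrow> 0) F"

definition absolutely_continuous_on_interval ::
  "('a::real_vector \<Rightarrow> real) \<Rightarrow> real \<Rightarrow> real \<Rightarrow> (real \<Rightarrow> 'a) \<Rightarrow> bool" where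
  "absolutely_continuous_on_interval p a b f \<longleftrightarrow>
     (\<forall>\<epsilon>>0. \<exists>\<delta>>0. \<forall>(n::nat) x y.
        (\<forall>i<n. a \<le> x i \<and> x i \<le> y i \<and> y i \<le> b) \<and>
        (\<forall>i<n. \<forall>j<n. i \<noteq> j \<longrightarrow> {x i<..<y i} \<inter> {x j<..<y j} = {}) \<and>
        (\<Sum>i<n. y i - x i) < \<delta>
        \<longrightarrow> (\<Sum>i<n. p (f (y i) - f (x i))) < \<epsilon>)"

definition locally_absolutely_continuous ::
  "('a::real_vector \<Rightarrow> real) \<Rightarrow> real \<Rightarrow> (real \<Rightarrow> 'a) \<Rightarrow> bool" where
  "locally_absolutely_continuous p T f \<longleftrightarrow>
     (\<forall>a b. 0 < a \<and> a \<le> b \<and> b < T \<longrightarrow> absolutely_continuous_on_interval p a b f)"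

(* V(f,t), with values in [0,\<infinity>]. *)
definition variation_limsup ::
  "('a::real_vector \<Rightarrow> real) \<Rightarrow> real \<Rightarrow> (real \<Rightarrow> 'a) \<Rightarrow> real \<Rightarrow> ennreal" where
  "variation_limsup p \<omega> f t =
     Limsup (at (0::real)) (\<lambda>\<xi>.
       \<integral>\<^sup>+s\<in>{0<..<t}. ennreal (exp (- \<omega> * s) * p ((f (s + \<xi> * s) - f s) /\<^sub>R \<xi>)) \<partial>lebesgue)"

end

theory Submission
  imports Defs "HOL-Real_Asymp.Real_Asymp"
begin

text \<open>With \<open>\<lambda> = 1 + h / t\<close> the homogeneity (ii) turns a time shift into a rescaling of the data:
  \<open>T\<^bsub>t+h\<^esub>(u, f) - T\<^sub>t(u, f)\<close> equals
  \<open>\<lambda> (T\<^sub>t(u/\<lambda>, f(\<lambda> \<cdot>)) - T\<^sub>t(u, f)) + (\<lambda> - 1) T\<^sub>t(u, f)\<close>, and both terms are controlled by (i),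
  the second one by comparison with \<open>T\<^sub>t(0, 0) = 0\<close>.

  For locally absolutely continuous \<open>f\<close>, Bochner integrals in the seminormed space are avoided:
  \<open>p (f y - f x) \<le> \<integral> p (f')\<close> over \<open>[x, y]\<close> is obtained directly from Henstock--Kurzweil
  Riemann sums. Integrating this over \<open>s\<close> with \<open>y = (1 + \<xi>) s\<close> and exchanging the
  integrals produces the weight \<open>s\<close> in front of \<open>p (f' s)\<close>.\<close>

section \<open>Absolute continuity with respect to a seminorm\<close>

text \<open>With only a seminorm the derivative is fixed up to vectors of seminorm 0, so the
  analysis concerns real functions such as p (f' s). The Riemann sums serve in two directions.
  Bounding increments by integrals controls the quotients; but the quotient at s < t sees
  \<open>f\<close> up to time (1 + \<xi>) t, and integrability of p (f') past t is not given. The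
  opposite bound, of the integral of p (f') over [t, b] by sums of increments of \<open>f\<close>,
  supplies it and makes the overhang vanish as b decreases to t. Near 0 the integrals may be
  infinite, hence the limits in [0, \<infinity>]. In the bracket one p u pays for replacing u by u /
  \<lambda>, the other for the comparison with zero data; 1 + h / t is \<lambda> itself. Exchanging
  the weight at s for the weight at r costs a factor exp (|\<omega>| T \<xi>), which tends to
  1.\<close>

lemma sum_content_le_measure:
  fixes q :: "('b::euclidean_space \<times> 'b set) set"
  assumes q: "q tagged_partial_division_of S" and U: "U \<in> lmeasurable"
    and sub: "\<And>x K. (x, K) \<in> q \<Longrightarrow> K \<subseteq> U"
  shows "(\<Sum>(x,K)\<in>q. measure lborel K) \<le> measure lebesgue U"
proof -
  let ?D = "snd ` q"
  have D: "?D division_of \<Union>?D"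
    using partial_division_of_tagged_division[OF q] .
  \<comment> \<open>Two tags can share an interval only if its interior is empty; its content is
    then 0 and merging the two terms loses nothing.\<close>
  have "(\<Sum>(x,K)\<in>q. measure lborel K) = sum (measure lborel) ?D"
    by (rule sum.over_tagged_division_lemma[OF tagged_partial_division_of_Union_self[OF q]])
       (simp add: content_eq_0_interior)
  also have "\<dots> = measure lebesgue (\<Union>?D)"
    unfolding content_division[OF D, symmetric]
  proof (intro sum.cong refl)
    fix K assume "K \<in> ?D"
    then obtain u v where "K = cbox u v"
      using division_ofD(4)[OF D] by blast
    then show "measure lborel K = measure lebesgue K"
      by simp
  qed
  also have "\<dots> \<le> measure lebesgue U"
  proof (rule measure_mono_fmeasurable)
    show "\<Union>?D \<in> sets lebesgue"
      using D by (meson fmeasurableD lmeasurable_division)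
    show "\<Union>?D \<subseteq> U"
      using sub by force
  qed (fact U)
  finally show ?thesis .
qed

section \<open>Seminorm inequalities and derivatives with respect to a seminorm\<close>

context
  fixes p :: "'a::real_vector \<Rightarrow> real"
  assumes p: "is_seminorm p"
begin

lemma seminorm_nonneg: "0 \<le> p x"
  using p by (simp add: is_seminorm_def)

lemma seminorm_scaleR: "p (c *\<^sub>R x) = \<bar>c\<bar> * p x"
  using p by (simp add: is_seminorm_def)

lemma seminorm_triangle: "p (x + y) \<le> p x + p y"
  using p by (simp add: is_seminorm_def)

lemma seminorm_zero: "p 0 = 0"
  using seminorm_scaleR[of 0 0] by simp

lemma seminorm_minus: "p (- x) = p x"
  using seminorm_scaleR[of "-1" x] by simp

lemma seminorm_minus_commute: "p (x - y) = p (y - x)"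
  using seminorm_minus[of "x - y"] by simp

lemma seminorm_triangle_sub: "p x \<le> p y + p (x - y)"
  using seminorm_triangle[of y "x - y"] by simp

lemma seminorm_triangle3: "p (x - y) \<le> p x + p y"
  using seminorm_triangle[of x "- y"] by (simp add: seminorm_minus)

lemma seminorm_diff_abs_le: "\<bar>p x - p y\<bar> \<le> p (x - y)"
  using seminorm_triangle_sub[of x y] seminorm_triangle_sub[of y x]
  by (simp add: seminorm_minus_commute abs_le_iff)

lemma seminorm_tendsto:
  assumes "((\<lambda>x. p (g x - l)) \<longlongrightarrow> 0) F"
  shows "((\<lambda>x. p (g x)) \<longlongrightarrow> p l) F"
proof (rule LIM_zero_cancel, rule tendsto_rabs_zero_cancel, rule tendsto_sandwich)
  show "\<forall>\<^sub>F x in F. 0 \<le> \<bar>p (g x) - p l\<bar>" "\<forall>\<^sub>F x in F. \<bar>p (g x) - p l\<bar> \<le> p (g x - l)"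
    by (simp_all add: seminorm_diff_abs_le)
qed (use assms in auto)

text \<open>A straddle lemma: the tag of a gauge-fine interval may lie anywhere between the
  endpoints, so both are compared with \<open>x\<close>. The one-sided errors add up to
  \<open>e * (v - u)\<close> because \<open>x\<close> separates \<open>u\<close> from
  \<open>v\<close>.\<close>

lemma seminorm_derivative_straddle:
  assumes "has_seminorm_derivative p f D x (at 0)" and "e > 0"
  obtains d where "d > 0"
    "\<And>u v. u \<le> x \<Longrightarrow> x \<le> v \<Longrightarrow> x - u < d \<Longrightarrow> v - x < d \<Longrightarrow>
       p (f v - f u - (v - u) *\<^sub>R D) \<le> e * (v - u)"
proof -
  have "\<forall>\<^sub>F h in at 0. p ((f (x + h) - f x) /\<^sub>R h - D) < e"
    using assms by (auto simp: has_seminorm_derivative_def dest!: order_tendstoD(2))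
  then obtain d where d: "d > 0" "\<And>h. h \<noteq> 0 \<Longrightarrow> \<bar>h\<bar> < d \<Longrightarrow> p ((f (x + h) - f x) /\<^sub>R h - D) < e"
    by (auto simp: eventually_at)
  have one_sided: "p (f y - f x - (y - x) *\<^sub>R D) \<le> e * \<bar>y - x\<bar>" if "\<bar>y - x\<bar> < d" for y
  proof (cases "y = x")
    case False
    have "f y - f x - (y - x) *\<^sub>R D = (y - x) *\<^sub>R ((f (x + (y - x)) - f x) /\<^sub>R (y - x) - D)"
      using False by (simp add: scaleR_diff_right)
    then have "p (f y - f x - (y - x) *\<^sub>R D) = \<bar>y - x\<bar> * p ((f (x + (y - x)) - f x) /\<^sub>R (y - x) - D)"
      by (simp only: seminorm_scaleR)
    also have "\<dots> \<le> \<bar>y - x\<bar> * e"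
      using d(2)[of "y - x"] that False by (intro mult_left_mono) auto
    finally show ?thesis by (simp add: mult.commute)
  qed (simp add: seminorm_zero)
  show thesis
  proof
    fix u v assume uv: "u \<le> x" "x \<le> v" "x - u < d" "v - x < d"
    have "f v - f u - (v - u) *\<^sub>R D
            = (f v - f x - (v - x) *\<^sub>R D) - (f u - f x - (u - x) *\<^sub>R D)"
      by (simp add: algebra_simps)
    then have "p (f v - f u - (v - u) *\<^sub>R D)
        \<le> p (f v - f x - (v - x) *\<^sub>R D) + p (f u - f x - (u - x) *\<^sub>R D)"
      by (simp only: seminorm_triangle3)
    also have "\<dots> \<le> e * \<bar>v - x\<bar> + e * \<bar>u - x\<bar>"
      using uv by (intro add_mono one_sided) auto
    also have "\<dots> = e * (v - u)"
      using uv by (simp add: algebra_simps)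
    finally show "p (f v - f u - (v - u) *\<^sub>R D) \<le> e * (v - u)" .
  qed (fact d(1))
qed

section \<open>Absolute continuity on tagged divisions\<close>

text \<open>The elements of \<open>q\<close> are numbered by a bijection and each \<open>K\<close>
  is replaced by its endpoints. Distinct elements have disjoint interiors, also when a degenerate
  interval recurs with several tags, so the definition applies.\<close>

lemma absolutely_continuous_partial_division:
  assumes "absolutely_continuous_on_interval p a b f" and "\<epsilon> > 0"
  obtains \<delta> where "\<delta> > 0"
    "\<And>q. q tagged_partial_division_of {a..b} \<Longrightarrow> (\<Sum>(x,K)\<in>q. measure lborel K) < \<delta> \<Longrightarrow>
       (\<Sum>(x,K)\<in>q. p (f (Sup K) - f (Inf K))) < \<epsilon>"
proof -
  obtain \<delta> where \<delta>: "\<delta> > 0" "\<And>(n::nat) x y.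
        (\<forall>i<n. a \<le> x i \<and> x i \<le> y i \<and> y i \<le> b) \<Longrightarrow>
        (\<forall>i<n. \<forall>j<n. i \<noteq> j \<longrightarrow> {x i<..<y i} \<inter> {x j<..<y j} = {}) \<Longrightarrow>
        (\<Sum>i<n. y i - x i) < \<delta> \<Longrightarrow> (\<Sum>i<n. p (f (y i) - f (x i))) < \<epsilon>"
    using assms unfolding absolutely_continuous_on_interval_def by auto
  show thesis
  proof
    fix q assume q: "q tagged_partial_division_of {a..b}" and small: "(\<Sum>(x,K)\<in>q. measure lborel K) < \<delta>"
    have fin: "finite q"
      using q by (rule tagged_partial_division_ofD)
    then obtain h where h: "bij_betw h {..<card q} q"
      using ex_bij_betw_nat_finite[of q] by (auto simp: atLeast0LessThan)
    define x where "x i = Inf (snd (h i))" for i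
    define y where "y i = Sup (snd (h i))" for i
    have interval: "\<exists>u v. K = {u..v} \<and> u \<le> v \<and> a \<le> u \<and> v \<le> b" if "(z, K) \<in> q" for z K
    proof -
      have zK: "z \<in> K" "K \<subseteq> {a..b}" and "\<exists>u v. K = cbox u v"
        using tagged_partial_division_ofD[OF q] that by blast+
      then obtain u v where "K = {u..v}"
        by auto
      with zK show ?thesis
        by (intro exI[of _ u] exI[of _ v]) auto
    qed
    have K: "snd (h i) = {x i..y i} \<and> x i \<le> y i \<and> a \<le> x i \<and> y i \<le> b" if "i < card q" for i
    proof -
      have "(fst (h i), snd (h i)) \<in> q"
        using bij_betwE[OF h] that by simp
      then obtain u v where "snd (h i) = {u..v}" "u \<le> v" "a \<le> u" "v \<le> b"
        using interval by metis
      then show ?thesis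
        by (simp add: x_def y_def)
    qed
    have reindex: "(\<Sum>i<card q. g (h i)) = sum g q" for g :: "_ \<Rightarrow> real"
      by (rule sum.reindex_bij_betw[OF h])
    have "(\<Sum>i<card q. p (f (y i) - f (x i))) < \<epsilon>"
    proof (rule \<delta>(2))
      show "\<forall>i<card q. a \<le> x i \<and> x i \<le> y i \<and> y i \<le> b"
        using K by blast
      show "\<forall>i<card q. \<forall>j<card q. i \<noteq> j \<longrightarrow> {x i<..<y i} \<inter> {x j<..<y j} = {}"
      proof (intro allI impI)
        fix i j assume ij: "i < card q" "j < card q" "i \<noteq> j"
        then have "h i \<noteq> h j" "h i \<in> q" "h j \<in> q"
          using h by (auto simp: bij_betw_def inj_on_def)
        then have "interior (snd (h i)) \<inter> interior (snd (h j)) = {}"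
          using tagged_partial_division_ofD(5)[OF q, of "fst (h i)" "snd (h i)" "fst (h j)" "snd (h j)"]
          by simp
        then show "{x i<..<y i} \<inter> {x j<..<y j} = {}"
          using K[OF ij(1)] K[OF ij(2)] by (simp add: interior_atLeastAtMost_real)
      qed
      have "(\<Sum>i<card q. y i - x i) = (\<Sum>i<card q. measure lborel (snd (h i)))"
        using K by (intro sum.cong) auto
      also have "\<dots> < \<delta>"
        using small by (simp add: reindex[where g = "\<lambda>z. measure lborel (snd z)"] case_prod_beta)
      finally show "(\<Sum>i<card q. y i - x i) < \<delta>" .
    qed
    then show "(\<Sum>(x,K)\<in>q. p (f (Sup K) - f (Inf K))) < \<epsilon>"
      by (simp add: x_def y_def case_prod_beta
          reindex[where g = "\<lambda>z. p (f (Sup (snd z)) - f (Inf (snd z)))"])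
  qed (fact \<delta>(1))
qed

text \<open>By outer regularity a null set lies in an open set of measure below the
  \<open>\<delta>\<close> of absolute continuity. Openness lets \<open>U\<close> act as the gauge
  value at every tag in \<open>N\<close>.\<close>

lemma absolutely_continuous_negligible_tags:
  assumes ac: "absolutely_continuous_on_interval p a b f"
    and N: "N \<in> null_sets lebesgue" and "\<epsilon> > 0"
  obtains U where "open U" "N \<subseteq> U"
    "\<And>q. q tagged_partial_division_of {a..b} \<Longrightarrow> (\<And>x K. (x, K) \<in> q \<Longrightarrow> K \<subseteq> U) \<Longrightarrow>
       (\<Sum>(x,K)\<in>q. p (f (Sup K) - f (Inf K))) < \<epsilon>"
proof -
  obtain \<delta> where \<delta>: "\<delta> > 0"
    "\<And>q. q tagged_partial_division_of {a..b} \<Longrightarrow> (\<Sum>(x,K)\<in>q. measure lborel K) < \<delta> \<Longrightarrow>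
       (\<Sum>(x,K)\<in>q. p (f (Sup K) - f (Inf K))) < \<epsilon>"
    using absolutely_continuous_partial_division[OF ac \<open>\<epsilon> > 0\<close>] by blast
  obtain U where U: "open U" "N \<subseteq> U" "emeasure lebesgue (U - N) < ennreal \<delta>"
    using sets_lebesgue_outer_open[of N \<delta>] null_setsD2[OF N] \<delta>(1) by blast
  have "emeasure lebesgue U = emeasure lebesgue (U - N)"
    using N U(1) by (simp add: emeasure_Diff_null_set)
  with U(3) have em: "emeasure lebesgue U < ennreal \<delta>"
    by simp
  then have "U \<in> lmeasurable"
    using U(1) by (intro fmeasurableI) (auto intro: less_trans)
  moreover have "measure lebesgue U < \<delta>"
    using em \<delta>(1) \<open>U \<in> lmeasurable\<close> by (simp add: emeasure_eq_measure2 ennreal_less_iff)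
  ultimately show thesis
    by (intro that[OF U(1,2)] \<delta>(2)) (auto intro: le_less_trans[OF sum_content_le_measure])
qed

text \<open>Off \<open>N\<close> the increment of \<open>f\<close> over a small interval is compared with \<open>p (D x)\<close> through the
  derivative; the intervals tagged in \<open>N\<close> lie in an open set of small measure, where absolute
  continuity makes the total increment small.\<close>

lemma absolutely_continuous_Riemann_sums:
  assumes ac: "absolutely_continuous_on_interval p a b f" and "a \<le> b"
    and N: "N \<in> null_sets lebesgue"
    and D: "\<forall>x\<in>{a..b} - N. has_seminorm_derivative p f (D x) x (at 0)"
    and \<phi>: "\<forall>x\<in>{a..b}. \<phi> x = (if x \<in> N then 0 else p (D x))"
    and "\<epsilon> > 0"
  obtains \<gamma> where "gauge \<gamma>"
    "\<And>q. q tagged_division_of {a..b} \<Longrightarrow> \<gamma> fine q \<Longrightarrow>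
       \<bar>(\<Sum>(x,K)\<in>q. p (f (Sup K) - f (Inf K))) - (\<Sum>(x,K)\<in>q. measure lborel K * \<phi> x)\<bar> < \<epsilon>"
proof -
  \<comment> \<open>Budget for the tags off \<open>N\<close>: over a division of total length
    \<open>b - a\<close> it sums to at most half of \<open>\<epsilon>\<close>. The summand 1 covers
    the case \<open>a = b\<close>.\<close>
  define e where "e = \<epsilon> / 2 / (b - a + 1)"
  have e: "e > 0" "e * (b - a) \<le> \<epsilon> / 2"
    using \<open>\<epsilon> > 0\<close> \<open>a \<le> b\<close> by (auto simp: e_def field_simps)
  obtain U where U: "open U" "N \<subseteq> U"
    "\<And>q. q tagged_partial_division_of {a..b} \<Longrightarrow> (\<And>x K. (x, K) \<in> q \<Longrightarrow> K \<subseteq> U) \<Longrightarrow>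
       (\<Sum>(x,K)\<in>q. p (f (Sup K) - f (Inf K))) < \<epsilon> / 2"
    using absolutely_continuous_negligible_tags[OF ac N, of "\<epsilon> / 2"] \<open>\<epsilon> > 0\<close> by auto
  have "\<forall>x\<in>{a..b} - N. \<exists>d>0. \<forall>u v. u \<le> x \<longrightarrow> x \<le> v \<longrightarrow> x - u < d \<longrightarrow> v - x < d \<longrightarrow>
      p (f v - f u - (v - u) *\<^sub>R D x) \<le> e * (v - u)"
  proof
    fix x assume "x \<in> {a..b} - N"
    from seminorm_derivative_straddle[OF D[rule_format, OF this] e(1)] obtain d where "d > 0"
      "\<And>u v. u \<le> x \<Longrightarrow> x \<le> v \<Longrightarrow> x - u < d \<Longrightarrow> v - x < d \<Longrightarrow>
        p (f v - f u - (v - u) *\<^sub>R D x) \<le> e * (v - u)"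
      by blast
    then show "\<exists>d>0. \<forall>u v. u \<le> x \<longrightarrow> x \<le> v \<longrightarrow> x - u < d \<longrightarrow> v - x < d \<longrightarrow>
        p (f v - f u - (v - u) *\<^sub>R D x) \<le> e * (v - u)"
      by blast
  qed
  from bchoice[OF this] obtain d where d: "\<forall>x\<in>{a..b} - N. d x > 0 \<and>
      (\<forall>u v. u \<le> x \<longrightarrow> x \<le> v \<longrightarrow> x - u < d x \<longrightarrow> v - x < d x \<longrightarrow>
        p (f v - f u - (v - u) *\<^sub>R D x) \<le> e * (v - u))" ..
  \<comment> \<open>A gauge needs an open neighbourhood at every real, hence the default
    \<open>UNIV\<close>.\<close>
  define \<gamma> where "\<gamma> x = (if x \<in> N then U else if x \<in> {a..b} then ball x (d x) else UNIV)" for x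
  show thesis
  proof
    show "gauge \<gamma>"
      using U(1,2) d by (auto simp: gauge_def \<gamma>_def)
    fix q assume q: "q tagged_division_of {a..b}" and fine: "\<gamma> fine q"
    have fin: "finite q"
      using q by (rule tagged_division_of_finite)
    have partial: "q tagged_partial_division_of {a..b}"
      using q by (simp add: tagged_division_of_def)
    define q' where "q' = {z \<in> q. fst z \<in> N}"
    have q': "q' \<subseteq> q"
      by (auto simp: q'_def)
    have on_N: "(\<Sum>(x,K)\<in>q'. p (f (Sup K) - f (Inf K))) < \<epsilon> / 2"
    proof (rule U(3))
      show "q' tagged_partial_division_of {a..b}"
        using partial q' by (rule tagged_partial_division_subset)
      show "K \<subseteq> U" if "(x, K) \<in> q'" for x K
        using fineD[OF fine, of x K] that by (simp add: q'_def \<gamma>_def)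
    qed
    \<comment> \<open>In \<open>N\<close> the value of \<open>\<phi>\<close> is 0, so the whole
      increment counts as error and is later absorbed by \<open>on_N\<close>; off \<open>N\<close>
      the straddle estimate bounds the error.\<close>
    have pointwise: "\<bar>p (f (Sup K) - f (Inf K)) - measure lborel K * \<phi> x\<bar>
        \<le> e * measure lborel K + (if x \<in> N then p (f (Sup K) - f (Inf K)) else 0)"
      if xK: "(x, K) \<in> q" for x K
    proof -
      have x: "x \<in> K" "K \<subseteq> {a..b}" and "\<exists>u v. K = cbox u v" and sub: "K \<subseteq> \<gamma> x"
        using tagged_partial_division_ofD[OF partial] xK fineD[OF fine xK] by blast+
      then obtain u v where "K = cbox u v"
        by blast
      with x have K: "K = {u..v}" "u \<le> x" "x \<le> v"
        by auto
      show ?thesis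
      proof (cases "x \<in> N")
        case True
        then have "\<phi> x = 0"
          using x bspec[OF \<phi>, of x] by auto
        then show ?thesis
          using True K e(1) seminorm_nonneg[of "f v - f u"] by simp
      next
        case False
        have xab: "x \<in> {a..b} - N"
          using x False by auto
        have "{u..v} \<subseteq> ball x (d x)"
          using sub K False xab by (auto simp: \<gamma>_def)
        moreover have "u \<in> {u..v}" "v \<in> {u..v}"
          using K by auto
        ultimately have "u \<in> ball x (d x)" "v \<in> ball x (d x)"
          by blast+
        then have "p (f v - f u - (v - u) *\<^sub>R D x) \<le> e * (v - u)"
          using K(2,3) bspec[OF d xab] by (simp add: dist_real_def)
        then have "\<bar>p (f v - f u) - p ((v - u) *\<^sub>R D x)\<bar> \<le> e * (v - u)"
          using seminorm_diff_abs_le[of "f v - f u" "(v - u) *\<^sub>R D x"] by linarith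
        then show ?thesis
          using K False bspec[OF \<phi>, of x] xab by (simp add: seminorm_scaleR)
      qed
    qed
    have "\<bar>(\<Sum>(x,K)\<in>q. p (f (Sup K) - f (Inf K))) - (\<Sum>(x,K)\<in>q. measure lborel K * \<phi> x)\<bar>
        = \<bar>\<Sum>(x,K)\<in>q. p (f (Sup K) - f (Inf K)) - measure lborel K * \<phi> x\<bar>"
      by (simp add: sum_subtractf case_prod_beta)
    also have "\<dots> \<le> (\<Sum>(x,K)\<in>q. \<bar>p (f (Sup K) - f (Inf K)) - measure lborel K * \<phi> x\<bar>)"
      unfolding case_prod_beta by (rule sum_abs)
    also have "\<dots> \<le> (\<Sum>(x,K)\<in>q. e * measure lborel K + (if x \<in> N then p (f (Sup K) - f (Inf K)) else 0))"
      using pointwise by (intro sum_mono) auto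
    also have "\<dots> = e * (\<Sum>(x,K)\<in>q. measure lborel K) + (\<Sum>(x,K)\<in>q'. p (f (Sup K) - f (Inf K)))"
      using fin unfolding case_prod_beta q'_def
      by (simp add: sum.distrib sum_distrib_left sum.inter_filter)
    also have "(\<Sum>(x,K)\<in>q. measure lborel K) = b - a"
      using additive_content_tagged_division[of q a b] q \<open>a \<le> b\<close> by simp
    finally show "\<bar>(\<Sum>(x,K)\<in>q. p (f (Sup K) - f (Inf K))) - (\<Sum>(x,K)\<in>q. measure lborel K * \<phi> x)\<bar> < \<epsilon>"
      using on_N e(2) by linarith
  qed
qed

section \<open>Increments against gauge integrals\<close>

text \<open>Telescoping takes place in the reals: p (f x - f a) vanishes at \<open>a\<close>, and
  the reverse triangle inequality bounds its change over each \<open>K\<close>.\<close>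

lemma seminorm_increment_le_sum:
  fixes f :: "real \<Rightarrow> 'a"
  assumes "q tagged_division_of {a..b}" and "a \<le> b"
  shows "p (f b - f a) \<le> (\<Sum>(x,K)\<in>q. p (f (Sup K) - f (Inf K)))"
proof -
  have "p (f b - f a) = (\<Sum>(x,K)\<in>q. p (f (Sup K) - f a) - p (f (Inf K) - f a))"
    using additive_tagged_division_1[OF \<open>a \<le> b\<close> assms(1), of "\<lambda>x. p (f x - f a)"]
    by (simp add: seminorm_zero)
  also have "\<dots> \<le> (\<Sum>(x,K)\<in>q. p (f (Sup K) - f (Inf K)))"
    using seminorm_diff_abs_le[of "f (Sup K) - f a" "f (Inf K) - f a" for K]
    by (intro sum_mono) (auto simp: abs_le_iff)
  finally show ?thesis .
qed

text \<open>A division fine for the intersection of two gauges serves both estimates.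
  \<open>\<psi>\<close> is kept apart from \<open>\<phi>\<close>: it is \<open>\<phi>\<close> itself
  for increment bounds, and a truncation of it where integrability of \<open>\<phi>\<close> is still
  open.\<close>

lemma absolutely_continuous_Riemann_sum_exists:
  fixes \<psi> :: "real \<Rightarrow> real"
  assumes ac: "absolutely_continuous_on_interval p a b f" and "a \<le> b"
    and N: "N \<in> null_sets lebesgue"
    and D: "\<forall>x\<in>{a..b} - N. has_seminorm_derivative p f (D x) x (at 0)"
    and \<phi>: "\<forall>x\<in>{a..b}. \<phi> x = (if x \<in> N then 0 else p (D x))"
    and int: "(\<psi> has_integral I) {a..b}"
    and \<epsilon>: "\<epsilon> > 0"
  shows "\<exists>q. q tagged_division_of {a..b} \<and>
       \<bar>(\<Sum>(x,K)\<in>q. p (f (Sup K) - f (Inf K))) - (\<Sum>(x,K)\<in>q. measure lborel K * \<phi> x)\<bar> < \<epsilon> \<and>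
       \<bar>(\<Sum>(x,K)\<in>q. measure lborel K * \<psi> x) - I\<bar> < \<epsilon>"
proof (rule absolutely_continuous_Riemann_sums[OF ac \<open>a \<le> b\<close> N D \<phi> \<epsilon>])
  fix \<gamma> assume \<gamma>: "gauge \<gamma>"
    "\<And>q. q tagged_division_of {a..b} \<Longrightarrow> \<gamma> fine q \<Longrightarrow>
       \<bar>(\<Sum>(x,K)\<in>q. p (f (Sup K) - f (Inf K))) - (\<Sum>(x,K)\<in>q. measure lborel K * \<phi> x)\<bar> < \<epsilon>"
  have "\<exists>\<gamma>'. gauge \<gamma>' \<and> (\<forall>q. q tagged_division_of {a..b} \<and> \<gamma>' fine q \<longrightarrow>
       norm ((\<Sum>(x,K)\<in>q. measure lborel K *\<^sub>R \<psi> x) - I) < \<epsilon>)"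
    using int \<epsilon> by (simp only: has_integral_real)
  then obtain \<gamma>' where \<gamma>': "gauge \<gamma>'" "\<forall>q. q tagged_division_of {a..b} \<and> \<gamma>' fine q \<longrightarrow>
       norm ((\<Sum>(x,K)\<in>q. measure lborel K *\<^sub>R \<psi> x) - I) < \<epsilon>"
    by (elim exE conjE)
  obtain q where q: "q tagged_division_of {a..b}" "(\<lambda>x. \<gamma> x \<inter> \<gamma>' x) fine q"
    by (rule fine_division_exists_real[OF gauge_Int[OF \<gamma>(1) \<gamma>'(1)]])
  then have "\<gamma> fine q" "\<gamma>' fine q"
    by (simp_all add: fine_Int)
  then show ?thesis
    using \<gamma>(2)[OF q(1)] \<gamma>'(2)[rule_format, OF conjI[OF q(1)]] q(1)
    unfolding real_norm_def real_scaleR_def by blast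
qed

text \<open>Stands in for the fundamental theorem of calculus: the increment is below the sum of
  increments over any division, and for a suitable one that sum is near \<open>I\<close>.\<close>

lemma absolutely_continuous_increment_le:
  assumes ac: "absolutely_continuous_on_interval p a b f" and "a \<le> b"
    and N: "N \<in> null_sets lebesgue"
    and D: "\<forall>x\<in>{a..b} - N. has_seminorm_derivative p f (D x) x (at 0)"
    and \<phi>: "\<forall>x\<in>{a..b}. \<phi> x = (if x \<in> N then 0 else p (D x))"
    and int: "(\<phi> has_integral I) {a..b}"
  shows "p (f b - f a) \<le> I"
proof (rule field_le_epsilon)
  fix \<epsilon> :: real assume "\<epsilon> > 0"
  then have \<epsilon>: "\<epsilon> / 2 > 0" by simp
  show "p (f b - f a) \<le> I + \<epsilon>"
    using absolutely_continuous_Riemann_sum_exists[OF ac \<open>a \<le> b\<close> N D \<phi> int \<epsilon>]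
  proof (elim exE conjE)
    fix q assume q: "q tagged_division_of {a..b}"
      "\<bar>(\<Sum>(x,K)\<in>q. p (f (Sup K) - f (Inf K))) - (\<Sum>(x,K)\<in>q. measure lborel K * \<phi> x)\<bar> < \<epsilon> / 2"
      "\<bar>(\<Sum>(x,K)\<in>q. measure lborel K * \<phi> x) - I\<bar> < \<epsilon> / 2"
    show ?thesis
      using q(2,3) seminorm_increment_le_sum[OF q(1) \<open>a \<le> b\<close>, of f] by linarith
  qed
qed

text \<open>The opposite direction: Riemann sums of \<open>\<phi>\<close> are close to sums of
  increments, hence at most \<open>M\<close> up to the error, and those of \<open>\<psi>\<close> lie
  below them.\<close>

lemma absolutely_continuous_integral_minorant_le:
  assumes ac: "absolutely_continuous_on_interval p a b f" and "a \<le> b"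
    and N: "N \<in> null_sets lebesgue"
    and D: "\<forall>x\<in>{a..b} - N. has_seminorm_derivative p f (D x) x (at 0)"
    and \<phi>: "\<forall>x\<in>{a..b}. \<phi> x = (if x \<in> N then 0 else p (D x))"
    and le: "\<And>x. x \<in> {a..b} \<Longrightarrow> \<psi> x \<le> \<phi> x"
    and int: "(\<psi> has_integral I) {a..b}"
    and M: "\<And>q. q tagged_division_of {a..b} \<Longrightarrow> (\<Sum>(x,K)\<in>q. p (f (Sup K) - f (Inf K))) \<le> M"
  shows "I \<le> M"
proof (rule field_le_epsilon)
  fix \<epsilon> :: real assume "\<epsilon> > 0"
  then have \<epsilon>: "\<epsilon> / 2 > 0" by simp
  show "I \<le> M + \<epsilon>"
    using absolutely_continuous_Riemann_sum_exists[OF ac \<open>a \<le> b\<close> N D \<phi> int \<epsilon>]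
  proof (elim exE conjE)
    fix q assume q: "q tagged_division_of {a..b}"
      "\<bar>(\<Sum>(x,K)\<in>q. p (f (Sup K) - f (Inf K))) - (\<Sum>(x,K)\<in>q. measure lborel K * \<phi> x)\<bar> < \<epsilon> / 2"
      "\<bar>(\<Sum>(x,K)\<in>q. measure lborel K * \<psi> x) - I\<bar> < \<epsilon> / 2"
    have "(\<Sum>(x,K)\<in>q. measure lborel K * \<psi> x) \<le> (\<Sum>(x,K)\<in>q. measure lborel K * \<phi> x)"
    proof (rule sum_mono, clarify)
      fix x K assume "(x, K) \<in> q"
      then have "x \<in> {a..b}"
        using tagged_division_ofD(2,3)[OF q(1)] by blast
      then show "measure lborel K * \<psi> x \<le> measure lborel K * \<phi> x"
        by (intro mult_left_mono le measure_nonneg)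
    qed
    with q(2,3) M[OF q(1)] show ?thesis by linarith
  qed
qed

section \<open>Continuity of increments and measurability of the derivative's seminorm\<close>

text \<open>A family of one interval in the definition gives continuity. The filter is
  \<open>nhds s\<close>, not \<open>at s\<close>, so that the limit composes with functions that
  take the value \<open>s\<close>.\<close>

lemma locally_absolutely_continuous_tendsto:
  assumes lac: "locally_absolutely_continuous p T f" and s: "0 < s" "s < T"
  shows "((\<lambda>y. p (f y - f s)) \<longlongrightarrow> 0) (nhds s)"
proof (rule tendstoI)
  fix \<epsilon> :: real assume "\<epsilon> > 0"
  have "absolutely_continuous_on_interval p (s / 2) ((s + T) / 2) f"
    using lac s by (simp add: locally_absolutely_continuous_def)
  with \<open>\<epsilon> > 0\<close> obtain \<delta> where \<delta>: "\<delta> > 0" "\<And>(n::nat) x y.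
        (\<forall>i<n. s / 2 \<le> x i \<and> x i \<le> y i \<and> y i \<le> (s + T) / 2) \<Longrightarrow>
        (\<forall>i<n. \<forall>j<n. i \<noteq> j \<longrightarrow> {x i<..<y i} \<inter> {x j<..<y j} = {}) \<Longrightarrow>
        (\<Sum>i<n. y i - x i) < \<delta> \<Longrightarrow> (\<Sum>i<n. p (f (y i) - f (x i))) < \<epsilon>"
    unfolding absolutely_continuous_on_interval_def by auto
  have close: "p (f y - f x) < \<epsilon>" if "s / 2 \<le> x" "x \<le> y" "y \<le> (s + T) / 2" "y - x < \<delta>" for x y
    using \<delta>(2)[of 1 "\<lambda>_. x" "\<lambda>_. y"] that by simp
  have "\<forall>\<^sub>F y in nhds s. s / 2 < y \<and> y < (s + T) / 2 \<and> s - \<delta> < y \<and> y < s + \<delta>"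
    using s \<open>\<delta> > 0\<close> by (intro eventually_conj order_tendstoD[OF filterlim_ident]) auto
  then show "\<forall>\<^sub>F y in nhds s. dist (p (f y - f s)) 0 < \<epsilon>"
  proof (rule eventually_mono)
    fix y assume y: "s / 2 < y \<and> y < (s + T) / 2 \<and> s - \<delta> < y \<and> y < s + \<delta>"
    have "p (f y - f s) < \<epsilon>"
    proof (cases "s \<le> y")
      case True
      then show ?thesis using y s by (intro close) auto
    next
      case False
      then have "p (f s - f y) < \<epsilon>" using y s by (intro close) auto
      then show ?thesis by (simp add: seminorm_minus_commute)
    qed
    then show "dist (p (f y - f s)) 0 < \<epsilon>"
      by (simp add: seminorm_nonneg)
  qed
qed

text \<open>As \<open>X\<close> has no topology, continuity is asked only of a real function. The
  change of f (g s) - f s splits into an increment of \<open>f\<close> near \<open>g s\<close> and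
  one near \<open>s\<close>.\<close>

lemma locally_absolutely_continuous_increment_continuous:
  assumes lac: "locally_absolutely_continuous p T f"
    and g: "continuous_on {0<..<T} g" "g ` {0<..<T} \<subseteq> {0<..<T}"
  shows "continuous_on {0<..<T} (\<lambda>s. p (f (g s) - f s))"
  unfolding continuous_on_def
proof
  fix s assume s: "s \<in> {0<..<T}"
  have "((\<lambda>y. p (f (g y) - f (g s)) + p (f y - f s)) \<longlongrightarrow> 0 + 0) (at s within {0<..<T})"
  proof (intro tendsto_add)
    have "(g \<longlongrightarrow> g s) (at s within {0<..<T})"
      using g(1) s by (simp add: continuous_on_def)
    moreover have "g s \<in> {0<..<T}"
      using g(2) s by blast
    ultimately show "((\<lambda>y. p (f (g y) - f (g s))) \<longlongrightarrow> 0) (at s within {0<..<T})"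
      by (intro filterlim_compose[OF locally_absolutely_continuous_tendsto[OF lac]]) simp_all
    show "((\<lambda>y. p (f y - f s)) \<longlongrightarrow> 0) (at s within {0<..<T})"
      using s by (intro filterlim_compose[OF locally_absolutely_continuous_tendsto[OF lac]]) auto
  qed
  then have sum: "((\<lambda>y. p (f (g y) - f (g s)) + p (f y - f s)) \<longlongrightarrow> 0) (at s within {0<..<T})"
    by simp
  have "((\<lambda>y. p ((f (g y) - f y) - (f (g s) - f s))) \<longlongrightarrow> 0) (at s within {0<..<T})"
  proof (rule tendsto_sandwich[OF _ _ tendsto_const sum])
    show "\<forall>\<^sub>F y in at s within {0<..<T}. 0 \<le> p (f (g y) - f y - (f (g s) - f s))"
      by (simp add: seminorm_nonneg)
    have "p (f (g y) - f y - (f (g s) - f s)) \<le> p (f (g y) - f (g s)) + p (f y - f s)" for y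
      using seminorm_triangle3[of "f (g y) - f (g s)" "f y - f s"] by (simp add: algebra_simps)
    then show "\<forall>\<^sub>F y in at s within {0<..<T}. p (f (g y) - f y - (f (g s) - f s))
        \<le> p (f (g y) - f (g s)) + p (f y - f s)"
      by simp
  qed
  then show "((\<lambda>s. p (f (g s) - f s)) \<longlongrightarrow> p (f (g s) - f s)) (at s within {0<..<T})"
    by (rule seminorm_tendsto)
qed

text \<open>Off \<open>N\<close>, p (D x) is the pointwise limit of seminorms of difference
  quotients, and these are continuous in \<open>x\<close>.\<close>

lemma seminorm_derivative_measurable:
  assumes lac: "locally_absolutely_continuous p T f"
    and N: "N \<in> null_sets lebesgue"
    and D: "\<forall>x\<in>{0<..<T} - N. has_seminorm_derivative p f (D x) x (at 0)"
  shows "(\<lambda>x. if x \<in> {0<..<T} - N then p (D x) else 0) \<in> borel_measurable lebesgue"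
proof -
  \<comment> \<open>The step scales with the distance to \<open>T\<close>, so x + h n x stays in (0,
    T) for every \<open>n\<close>; the 2 makes this strict already at \<open>n = 0\<close>.\<close>
  define h where "h n x = (T - x) / (real n + 2)" for n x
  define G where "G n x = indicator {0<..<T} x *\<^sub>R (p (f (x + h n x) - f x) / h n x)" for n x
  have h: "0 < h n x" "x + h n x < T" if "x < T" for n x
  proof -
    have "h n x \<le> (T - x) / 2"
      unfolding h_def using that by (intro divide_left_mono) auto
    also have "\<dots> < T - x"
      using that by simp
    finally show "x + h n x < T"
      by simp
    show "0 < h n x"
      using that by (simp add: h_def)
  qed
  have "continuous_on {0<..<T} (\<lambda>x. p (f (x + h n x) - f x) / h n x)" for n
  proof (intro continuous_on_divide locally_absolutely_continuous_increment_continuous[OF lac])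
    show "continuous_on {0<..<T} (h n)"
      unfolding h_def by (intro continuous_intros) auto
    then show "continuous_on {0<..<T} (\<lambda>x. x + h n x)"
      by (intro continuous_intros)
    show "(\<lambda>x. x + h n x) ` {0<..<T} \<subseteq> {0<..<T}"
    proof clarsimp
      fix x assume "0 < x" "x < T"
      then show "0 < x + h n x \<and> x + h n x < T"
        using h[of x n] by simp
    qed
    show "\<forall>x\<in>{0<..<T}. h n x \<noteq> 0"
      using less_imp_neq[OF h(1)] by (metis greaterThanLessThan_iff)
  qed
  then have "G n \<in> borel_measurable borel" for n
    unfolding G_def by (intro borel_measurable_continuous_on_indicator) auto
  then have "G n \<in> borel_measurable lebesgue" for n
    by (intro measurable_completion) simp
  then have meas: "(\<lambda>x. if x \<in> N then 0 else G n x) \<in> borel_measurable lebesgue" for n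
    using null_setsD2[OF N] by (intro measurable_If_set) auto
  show ?thesis
  proof (rule borel_measurable_LIMSEQ_real[OF _ meas])
    fix x
    show "(\<lambda>n. if x \<in> N then 0 else G n x) \<longlonglongrightarrow> (if x \<in> {0<..<T} - N then p (D x) else 0)"
    proof (cases "x \<in> {0<..<T} - N")
      case True
      then have x: "x < T" "0 < x" by auto
      have "(\<lambda>n. h n x) \<longlonglongrightarrow> 0"
        unfolding h_def by real_asymp
      then have "filterlim (\<lambda>n. h n x) (at 0) sequentially"
        using h(1)[OF x(1)] by (auto simp: filterlim_at less_imp_neq[symmetric])
      then have "(\<lambda>n. p ((f (x + h n x) - f x) /\<^sub>R h n x - D x)) \<longlonglongrightarrow> 0"
        using bspec[OF D True] unfolding has_seminorm_derivative_def by (rule filterlim_compose[rotated])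
      then have "(\<lambda>n. p ((f (x + h n x) - f x) /\<^sub>R h n x)) \<longlonglongrightarrow> p (D x)"
        by (rule seminorm_tendsto)
      moreover have "p ((f (x + h n x) - f x) /\<^sub>R h n x) = G n x" for n
        using h(1)[OF x(1), of n] x by (simp add: G_def seminorm_scaleR divide_inverse mult.commute)
      ultimately show ?thesis
        using True by simp
    next
      case False
      then have "(if x \<in> N then 0 else G n x) = 0" for n
        by (auto simp: G_def)
      then show ?thesis
        unfolding if_not_P[OF False] by simp
    qed
  qed
qed

section \<open>Passage to Lebesgue integrals with values in [0, \<infinity>]\<close>

text \<open>An infinite right-hand side is trivial; a finite one makes the nonnegative measurable
  \<open>\<phi>\<close> gauge integrable on the interval with the same value.\<close>

lemma absolutely_continuous_increment_le_nn_integral: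
  assumes ac: "absolutely_continuous_on_interval p a b f" and "a \<le> b"
    and N: "N \<in> null_sets lebesgue"
    and D: "\<forall>x\<in>{a..b} - N. has_seminorm_derivative p f (D x) x (at 0)"
    and \<phi>: "\<forall>x\<in>{a..b}. \<phi> x = (if x \<in> N then 0 else p (D x))"
    and meas: "\<phi> \<in> borel_measurable lebesgue"
  shows "ennreal (p (f b - f a)) \<le> (\<integral>\<^sup>+r\<in>{a..b}. ennreal (\<phi> r) \<partial>lebesgue)"
proof (cases "(\<integral>\<^sup>+r\<in>{a..b}. ennreal (\<phi> r) \<partial>lebesgue)")
  case (real I)
  define g where "g x = indicator {a..b} x * \<phi> x" for x
  have g: "g \<in> borel_measurable lebesgue"
    unfolding g_def using meas by (intro borel_measurable_times borel_measurable_indicator) auto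
  have g0: "0 \<le> g x" for x
    using \<phi> by (simp add: g_def indicator_def seminorm_nonneg)
  have "(\<integral>\<^sup>+x. ennreal (g x) \<partial>lebesgue) = ennreal I"
    unfolding real(2)[symmetric] by (intro nn_integral_cong) (auto simp: g_def indicator_def)
  then have "(g has_integral I) UNIV"
    using g g0 real by (simp add: has_integral_iff_nn_integral_lebesgue)
  also have "g = (\<lambda>x. if x \<in> {a..b} then \<phi> x else 0)"
    by (auto simp: g_def)
  finally have "(\<phi> has_integral I) {a..b}"
    by (simp only: has_integral_restrict_UNIV)
  then have "p (f b - f a) \<le> I"
    by (rule absolutely_continuous_increment_le[OF ac \<open>a \<le> b\<close> N D \<phi>])
  then show ?thesis
    using real by (simp add: ennreal_leI)
qed simp

text \<open>Finiteness of the integral is part of the conclusion. The truncations of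
  \<open>\<phi>\<close> at height \<open>k\<close> are bounded and measurable on a bounded interval,
  hence integrable minorants; monotone convergence removes \<open>k\<close>.\<close>

lemma absolutely_continuous_nn_integral_le:
  assumes ac: "absolutely_continuous_on_interval p a b f" and "a \<le> b"
    and N: "N \<in> null_sets lebesgue"
    and D: "\<forall>x\<in>{a..b} - N. has_seminorm_derivative p f (D x) x (at 0)"
    and \<phi>: "\<forall>x\<in>{a..b}. \<phi> x = (if x \<in> N then 0 else p (D x))"
    and meas: "\<phi> \<in> borel_measurable lebesgue"
    and M: "\<And>q. q tagged_division_of {a..b} \<Longrightarrow> (\<Sum>(x,K)\<in>q. p (f (Sup K) - f (Inf K))) \<le> M"
  shows "(\<integral>\<^sup>+r\<in>{a..b}. ennreal (\<phi> r) \<partial>lebesgue) \<le> ennreal M"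
proof -
  have \<phi>0: "0 \<le> \<phi> x" if "x \<in> {a..b}" for x
    using \<phi> that by (simp add: seminorm_nonneg)
  define \<psi> where "\<psi> k x = indicator {a..b} x * min (\<phi> x) (real k)" for k x
  have \<psi>: "\<psi> k \<in> borel_measurable lebesgue" for k
    unfolding \<psi>_def using meas
    by (intro borel_measurable_times borel_measurable_min borel_measurable_indicator) auto
  have \<psi>0: "0 \<le> \<psi> k x" for k x
    using \<phi>0 by (simp add: \<psi>_def indicator_def)
  have bound: "(\<integral>\<^sup>+x. ennreal (\<psi> k x) \<partial>lebesgue) \<le> ennreal M" for k
  proof -
    have "(\<integral>\<^sup>+x. ennreal (\<psi> k x) \<partial>lebesgue) \<le> (\<integral>\<^sup>+x. ennreal (real k) * indicator {a..b} x \<partial>lebesgue)"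
      by (intro nn_integral_mono) (auto simp: \<psi>_def indicator_def intro!: ennreal_leI)
    also have "\<dots> < \<infinity>"
      using \<open>a \<le> b\<close> by (subst nn_integral_cmult) (auto simp: ennreal_mult_less_top intro!: borel_measurable_indicator)
    finally obtain I where I: "I \<ge> 0" "(\<integral>\<^sup>+x. ennreal (\<psi> k x) \<partial>lebesgue) = ennreal I"
      by (cases "(\<integral>\<^sup>+x. ennreal (\<psi> k x) \<partial>lebesgue)") auto
    then have "(\<psi> k has_integral I) UNIV"
      using \<psi>[of k] \<psi>0[of k] by (simp add: has_integral_iff_nn_integral_lebesgue)
    also have "\<psi> k = (\<lambda>x. if x \<in> {a..b} then min (\<phi> x) (real k) else 0)"
      by (auto simp: \<psi>_def)
    finally have "((\<lambda>x. min (\<phi> x) (real k)) has_integral I) {a..b}"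
      by (simp only: has_integral_restrict_UNIV)
    then have "I \<le> M"
      by (rule absolutely_continuous_integral_minorant_le[OF ac \<open>a \<le> b\<close> N D \<phi>, rotated]) (auto intro: M)
    then show ?thesis
      by (simp add: I ennreal_leI)
  qed
  have "(\<integral>\<^sup>+r\<in>{a..b}. ennreal (\<phi> r) \<partial>lebesgue) = (\<integral>\<^sup>+r. (SUP k. ennreal (\<psi> k r)) \<partial>lebesgue)"
  proof (intro nn_integral_cong)
    fix r
    obtain k0 where "\<phi> r \<le> real k0"
      using real_arch_simple by blast
    then have "(SUP k. ennreal (\<psi> k r)) = ennreal (\<phi> r) * indicator {a..b} r"
      by (intro antisym SUP_least SUP_upper2[of k0])
         (auto simp: \<psi>_def indicator_def intro!: ennreal_leI)
    then show "ennreal (\<phi> r) * indicator {a..b} r = (SUP k. ennreal (\<psi> k r))" ..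
  qed
  also have "\<dots> = (SUP k. \<integral>\<^sup>+r. ennreal (\<psi> k r) \<partial>lebesgue)"
  proof (rule nn_integral_monotone_convergence_SUP)
    show "incseq (\<lambda>k r. ennreal (\<psi> k r))"
      by (auto simp: incseq_def le_fun_def \<psi>_def indicator_def intro!: ennreal_leI)
    show "(\<lambda>r. ennreal (\<psi> k r)) \<in> borel_measurable lebesgue" for k
      using \<psi> by (rule measurable_compose) simp
  qed
  also have "\<dots> \<le> ennreal M"
    using bound by (intro SUP_least)
  finally show ?thesis .
qed

text \<open>This controls the overhang past \<open>t\<close>: on a short interval absolute
  continuity makes all sums of increments small, and they dominate the integral.\<close>

lemma locally_absolutely_continuous_nn_integral_small:
  assumes lac: "locally_absolutely_continuous p T f" and t: "0 < t" "t < T" and "\<epsilon> > 0"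
    and N: "N \<in> null_sets lebesgue"
    and D: "\<forall>x\<in>{0<..<T} - N. has_seminorm_derivative p f (D x) x (at 0)"
    and \<phi>: "\<forall>x\<in>{0<..<T}. \<phi> x = (if x \<in> N then 0 else p (D x))"
    and meas: "\<phi> \<in> borel_measurable lebesgue"
  obtains b where "t < b" "b < T" "(\<integral>\<^sup>+r\<in>{t..b}. ennreal (\<phi> r) \<partial>lebesgue) \<le> ennreal \<epsilon>"
proof -
  have ac: "absolutely_continuous_on_interval p t b f" if "t \<le> b" "b < T" for b
    using lac t(1) that by (simp add: locally_absolutely_continuous_def)
  \<comment> \<open>The \<open>\<delta>\<close> of absolute continuity depends on the interval, so
    it is taken on a fixed larger one before \<open>b\<close> is chosen.\<close>
  define b0 where "b0 = (t + T) / 2"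
  have b0: "t < b0" "b0 < T"
    using t by (auto simp: b0_def)
  obtain \<delta> where \<delta>: "\<delta> > 0"
    "\<And>q. q tagged_partial_division_of {t..b0} \<Longrightarrow> (\<Sum>(x,K)\<in>q. measure lborel K) < \<delta> \<Longrightarrow>
       (\<Sum>(x,K)\<in>q. p (f (Sup K) - f (Inf K))) < \<epsilon>"
    using absolutely_continuous_partial_division[OF ac[OF less_imp_le[OF b0(1)] b0(2)] \<open>\<epsilon> > 0\<close>]
    by blast
  define b where "b = min b0 (t + \<delta> / 2)"
  have b: "t < b" "b < T" "b \<le> b0" "b - t < \<delta>"
    using b0 \<delta>(1) by (auto simp: b_def)
  have "(\<integral>\<^sup>+r\<in>{t..b}. ennreal (\<phi> r) \<partial>lebesgue) \<le> ennreal \<epsilon>"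
  proof (rule absolutely_continuous_nn_integral_le[OF ac _ N _ _ meas])
    show "\<forall>x\<in>{t..b} - N. has_seminorm_derivative p f (D x) x (at 0)"
      "\<forall>x\<in>{t..b}. \<phi> x = (if x \<in> N then 0 else p (D x))"
      using D \<phi> t b by auto
    fix q assume q: "q tagged_division_of {t..b}"
    then have q': "q tagged_partial_division_of {t..b}"
      by (simp add: tagged_division_of_def)
    have "q tagged_partial_division_of {t..b0}"
      unfolding tagged_partial_division_of_def
    proof (intro conjI allI impI)
      fix x K assume "(x, K) \<in> q"
      then show "x \<in> K" "K \<subseteq> {t..b0}" "\<exists>a b. K = cbox a b"
        using tagged_partial_division_ofD(2,3,4)[OF q', of x K] b(3) by auto
    qed (use tagged_partial_division_ofD(1,5)[OF q'] in blast)+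
    moreover have "(\<Sum>(x,K)\<in>q. measure lborel K) < \<delta>"
      using additive_content_tagged_division[of q t b] q b by simp
    ultimately show "(\<Sum>(x,K)\<in>q. p (f (Sup K) - f (Inf K))) \<le> \<epsilon>"
      using \<delta>(2) by (simp add: less_imp_le)
  qed (use b in auto)
  with b show thesis
    using that by blast
qed

end

section \<open>Limits superior of scaled difference quotients\<close>

text \<open>A \<open>z\<close> strictly between \<open>V\<close> and \<open>y\<close> is finite, so
  z * c \<xi> tends to \<open>z\<close> and ends below \<open>y\<close>. Applied with c \<xi> equal
  to 1 + \<xi> and to exp (|\<omega>| T \<xi>).\<close>

lemma Limsup_at_right_mult_le:
  fixes N :: "real \<Rightarrow> ennreal"
  assumes N: "Limsup (at_right 0) N \<le> V" and c: "(c \<longlongrightarrow> 1) (at_right (0::real))"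
  shows "Limsup (at_right 0) (\<lambda>\<xi>. ennreal (c \<xi>) * N \<xi>) \<le> V"
  unfolding Limsup_le_iff
proof (intro allI impI)
  fix y assume "y > V"
  then obtain z where z: "V < z" "z < y"
    using dense by blast
  then have "\<forall>\<^sub>F \<xi> in at_right 0. N \<xi> < z"
    using N by (intro Limsup_lessD) auto
  moreover have "((\<lambda>\<xi>. z * ennreal (c \<xi>)) \<longlongrightarrow> z * ennreal 1) (at_right 0)"
    using z(2) c by (intro ennreal_tendsto_cmult tendsto_ennrealI) (auto intro: less_le_trans)
  then have "\<forall>\<^sub>F \<xi> in at_right 0. z * ennreal (c \<xi>) < y"
    using z by (intro order_tendstoD(2)) auto
  ultimately show "\<forall>\<^sub>F \<xi> in at_right 0. ennreal (c \<xi>) * N \<xi> < y"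
  proof eventually_elim
    case (elim \<xi>)
    have "ennreal (c \<xi>) * N \<xi> \<le> ennreal (c \<xi>) * z"
      using elim by (intro mult_left_mono) auto
    then show ?case
      using elim by (simp add: mult.commute)
  qed
qed

lemma Limsup_at_right_rescale:
  fixes N :: "real \<Rightarrow> ennreal"
  assumes "t > 0"
  shows "Limsup (at_right 0) (\<lambda>h. N (h / t)) \<le> Limsup (at_right 0) N"
  unfolding Limsup_le_iff
proof (intro allI impI)
  fix y assume "y > Limsup (at_right 0) N"
  then have "\<forall>\<^sub>F \<xi> in at_right 0. N \<xi> < y"
    by (rule Limsup_lessD)
  moreover have "filterlim (\<lambda>h. h / t) (at_right 0) (at_right 0)"
    using assms by real_asymp
  ultimately show "\<forall>\<^sub>F h in at_right 0. N (h / t) < y"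
    by (rule eventually_compose_filterlim)
qed

text \<open>The Tonelli argument behind the passage from difference quotients to derivatives:
  \<open>r\<close> lies between \<open>s\<close> and \<open>(1 + \<xi>) s\<close> exactly when \<open>s\<close> lies in an interval of
  length \<open>\<xi> r / (1 + \<xi>)\<close> to the left of \<open>r\<close>, which produces the weight \<open>r\<close>.\<close>

lemma nn_integral_scaled_average_le:
  fixes \<phi> :: "real \<Rightarrow> ennreal"
  assumes \<phi>[measurable]: "\<phi> \<in> borel_measurable borel" and t: "0 < t" "t \<le> T" and "0 < \<xi>"
  shows "(\<integral>\<^sup>+s\<in>{0<..<t}. (ennreal (exp (- \<omega> * s) / \<xi>) * (\<integral>\<^sup>+r\<in>{s..s + \<xi> * s}. \<phi> r \<partial>lborel)) \<partial>lborel)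
    \<le> ennreal (exp (\<bar>\<omega>\<bar> * T * \<xi>)) *
        (\<integral>\<^sup>+r\<in>{0<..<(1 + \<xi>) * t}. (ennreal (exp (- \<omega> * r) * r) * \<phi> r) \<partial>lborel)"
proof -
  let ?K = "\<lambda>s r. ennreal (exp (- \<omega> * s) / \<xi>) * \<phi> r * indicator {0<..<t} s * indicator {s..s + \<xi> * s} r"
  have "(\<integral>\<^sup>+s\<in>{0<..<t}. (ennreal (exp (- \<omega> * s) / \<xi>) * (\<integral>\<^sup>+r\<in>{s..s + \<xi> * s}. \<phi> r \<partial>lborel)) \<partial>lborel)
      = (\<integral>\<^sup>+s. (\<integral>\<^sup>+r. ?K s r \<partial>lborel) \<partial>lborel)"
    by (subst nn_integral_cmult[symmetric] nn_integral_multc[symmetric]; simp add: ac_simps)+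
  also have "\<dots> = (\<integral>\<^sup>+r. (\<integral>\<^sup>+s. ?K s r \<partial>lborel) \<partial>lborel)"
  proof (rule lborel_pair.Fubini')
    \<comment> \<open>The interval for \<open>r\<close> moves with \<open>s\<close>; joint
      measurability is visible once it is written as a set of pairs.\<close>
    have eq: "(\<lambda>(r, s). ?K s r) = (\<lambda>z. ennreal (exp (- \<omega> * snd z) / \<xi>) * \<phi> (fst z) *
        indicator {0<..<t} (snd z) * indicator {z. snd z \<le> fst z \<and> fst z \<le> snd z + \<xi> * snd z} z)"
      by (auto simp: fun_eq_iff indicator_def)
    show "(\<lambda>(r, s). ?K s r) \<in> borel_measurable (lborel \<Otimes>\<^sub>M lborel)"
      unfolding eq by measurable
  qed
  also have "\<dots> \<le> (\<integral>\<^sup>+r. ennreal (exp (\<bar>\<omega>\<bar> * T * \<xi>)) *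
      (ennreal (exp (- \<omega> * r) * r) * \<phi> r * indicator {0<..<(1 + \<xi>) * t} r) \<partial>lborel)"
  proof (rule nn_integral_mono)
    fix r :: real
    \<comment> \<open>Since 0 \<le> r - s \<le> \<xi> s \<le> T \<xi> on the support of the kernel,
      this bounds the factor exp (- \<omega> s) / \<xi> independently of \<open>s\<close>, and the
      inner integral becomes a length.\<close>
    let ?C = "exp (\<bar>\<omega>\<bar> * T * \<xi>) * exp (- \<omega> * r) / \<xi>"
    show "(\<integral>\<^sup>+s. ?K s r \<partial>lborel) \<le> ennreal (exp (\<bar>\<omega>\<bar> * T * \<xi>)) *
      (ennreal (exp (- \<omega> * r) * r) * \<phi> r * indicator {0<..<(1 + \<xi>) * t} r)"
    proof (cases "0 < r \<and> r < (1 + \<xi>) * t")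
      case True
      have "(\<integral>\<^sup>+s. ?K s r \<partial>lborel)
          \<le> (\<integral>\<^sup>+s. ennreal ?C * \<phi> r * indicator {r / (1 + \<xi>)..r} s \<partial>lborel)"
      proof (rule nn_integral_mono)
        fix s :: real
        show "?K s r \<le> ennreal ?C * \<phi> r * indicator {r / (1 + \<xi>)..r} s"
        proof (cases "s \<in> {0<..<t} \<and> r \<in> {s..s + \<xi> * s}")
          case s: True
          have "\<xi> * s \<le> \<xi> * T"
            using s t \<open>0 < \<xi>\<close> by (intro mult_left_mono) auto
          with s have "r - s \<le> T * \<xi>"
            by (auto simp: mult.commute[of T])
          then have "\<bar>\<omega>\<bar> * (r - s) \<le> \<bar>\<omega>\<bar> * T * \<xi>"
            unfolding mult.assoc by (rule mult_left_mono) simp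
          moreover have "\<omega> * (r - s) \<le> \<bar>\<omega>\<bar> * (r - s)"
            using s by (intro mult_right_mono) auto
          ultimately have "- \<omega> * s \<le> \<bar>\<omega>\<bar> * T * \<xi> + - \<omega> * r"
            by (simp add: algebra_simps)
          then have "exp (- \<omega> * s) \<le> exp (\<bar>\<omega>\<bar> * T * \<xi>) * exp (- \<omega> * r)"
            by (simp flip: exp_add)
          then have "exp (- \<omega> * s) / \<xi> \<le> ?C"
            using \<open>0 < \<xi>\<close> by (intro divide_right_mono) auto
          moreover have "s \<in> {r / (1 + \<xi>)..r}"
            using s \<open>0 < \<xi>\<close> by (simp add: field_simps)
          ultimately show ?thesis
            using s by (simp add: ennreal_leI mult_right_mono del: times_divide_eq_left)
        qed (auto simp: indicator_def)
      qed
      also have "\<dots> = ennreal ?C * \<phi> r * ennreal (r - r / (1 + \<xi>))"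
      proof -
        have "r / (1 + \<xi>) \<le> r"
          using True \<open>0 < \<xi>\<close> by (simp add: field_simps)
        then show ?thesis
          by (subst nn_integral_cmult) simp_all
      qed
      also have "\<dots> = ennreal (?C * (r - r / (1 + \<xi>))) * \<phi> r"
      proof -
        have "r / (1 + \<xi>) \<le> r"
          using True \<open>0 < \<xi>\<close> by (simp add: field_simps)
        then show ?thesis
          using \<open>0 < \<xi>\<close> by (subst ennreal_mult) (simp_all add: mult_ac)
      qed
      also have "\<dots> \<le> ennreal (exp (\<bar>\<omega>\<bar> * T * \<xi>) * (exp (- \<omega> * r) * r)) * \<phi> r"
      proof (intro mult_right_mono ennreal_leI)
        \<comment> \<open>Its factor \<xi> cancels the 1 / \<xi> in \<open>?C\<close>; dropping the
          denominator leaves exactly the weight r.\<close>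
        have "r - r / (1 + \<xi>) = \<xi> * r / (1 + \<xi>)"
          using \<open>0 < \<xi>\<close> by (simp add: field_simps)
        also have "\<dots> \<le> \<xi> * r / 1"
          using True \<open>0 < \<xi>\<close> by (intro divide_left_mono) auto
        finally have "?C * (r - r / (1 + \<xi>)) \<le> ?C * (\<xi> * r)"
          using \<open>0 < \<xi>\<close> by (intro mult_left_mono) auto
        also have "\<dots> = exp (\<bar>\<omega>\<bar> * T * \<xi>) * (exp (- \<omega> * r) * r)"
          using \<open>0 < \<xi>\<close> by simp
        finally show "?C * (r - r / (1 + \<xi>)) \<le> exp (\<bar>\<omega>\<bar> * T * \<xi>) * (exp (- \<omega> * r) * r)" .
      qed simp
      also have "\<dots> = ennreal (exp (\<bar>\<omega>\<bar> * T * \<xi>)) *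
          (ennreal (exp (- \<omega> * r) * r) * \<phi> r * indicator {0<..<(1 + \<xi>) * t} r)"
        using True by (subst ennreal_mult) (simp_all add: mult_ac)
      finally show ?thesis .
    next
      case False
      have "?K s r = 0" for s
      proof (rule ccontr)
        assume "?K s r \<noteq> 0"
        then have s: "0 < s" "s < t" "s \<le> r" "r \<le> s + \<xi> * s"
          by (auto simp: indicator_def split: if_splits)
        have "\<xi> * s < \<xi> * t"
          using s \<open>0 < \<xi>\<close> by simp
        then show False
          using False s by (simp add: algebra_simps)
      qed
      then have "(\<integral>\<^sup>+s. ?K s r \<partial>lborel) = 0"
        by (simp only: nn_integral_const mult_zero_left)
      then show ?thesis
        by simp
    qed
  qed
  also have "\<dots> = ennreal (exp (\<bar>\<omega>\<bar> * T * \<xi>)) *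
      (\<integral>\<^sup>+r\<in>{0<..<(1 + \<xi>) * t}. (ennreal (exp (- \<omega> * r) * r) * \<phi> r) \<partial>lborel)"
    by (rule nn_integral_cmult) simp
  finally show ?thesis .
qed

section \<open>Upper limit of the quotients in terms of the derivative\<close>

lemma derivative_quotient_Limsup_le:
  assumes p: "is_seminorm p" and lac: "locally_absolutely_continuous p T f"
    and t: "0 < t" "t < T"
    and D: "AE s in lebesgue_on {0<..<T}. has_seminorm_derivative p f (D s) s (at 0)"
  shows "Limsup (at_right 0) (\<lambda>\<xi>. \<integral>\<^sup>+s\<in>{0<..<t}.
        ennreal (exp (- \<omega> * s) * p ((f (s + \<xi> * s) - f s) /\<^sub>R \<xi>)) \<partial>lebesgue)
    \<le> (\<integral>\<^sup>+s\<in>{0<..<t}. ennreal (exp (- \<omega> * s) * s * p (D s)) \<partial>lebesgue)"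
    (is "Limsup _ ?Q \<le> ?V")
proof -
  define N where "N = {s. \<not> (s \<in> {0<..<T} \<longrightarrow> has_seminorm_derivative p f (D s) s (at 0))}"
  have "AE s in lebesgue. s \<in> {0<..<T} \<longrightarrow> has_seminorm_derivative p f (D s) s (at 0)"
    using D by (subst (asm) AE_restrict_space_iff) auto
  then have N: "N \<in> null_sets lebesgue"
    by (simp add: completion.AE_iff_null_sets N_def)
  have deriv: "\<forall>x\<in>{0<..<T} - N. has_seminorm_derivative p f (D x) x (at 0)"
    by (simp add: N_def)
  define \<phi> where "\<phi> x = (if x \<in> {0<..<T} - N then p (D x) else 0)" for x
  have \<phi>: "\<phi> \<in> borel_measurable lebesgue"
    unfolding \<phi>_def by (rule seminorm_derivative_measurable[OF p lac N deriv])
  have \<phi>_eq: "\<forall>x\<in>{0<..<T}. \<phi> x = (if x \<in> N then 0 else p (D x))"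
    by (simp add: \<phi>_def)
  have "(\<lambda>x. ennreal (\<phi> x)) \<in> borel_measurable lebesgue"
    using \<phi> by (rule measurable_compose) simp
  \<comment> \<open>The Tonelli argument lives on Borel functions, so \<open>\<phi>\<close> is
    exchanged for a Borel function equal to it almost everywhere, which leaves all integrals
    unchanged.\<close>
  from completion_ex_borel_measurable[OF this] obtain \<phi>' :: "real \<Rightarrow> ennreal"
    where \<phi>'_meas: "\<phi>' \<in> borel_measurable lborel" and \<phi>': "AE x in lborel. ennreal (\<phi> x) = \<phi>' x"
    by blast
  have [measurable]: "\<phi>' \<in> borel_measurable borel"
    using \<phi>'_meas by simp
  have \<phi>'_int: "(\<integral>\<^sup>+r\<in>A. ennreal (\<phi> r) \<partial>lebesgue) = (\<integral>\<^sup>+r\<in>A. \<phi>' r \<partial>lborel)" for A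
    unfolding nn_integral_completion using \<phi>' by (intro nn_integral_cong_AE) (auto elim: eventually_mono)
  define w where "w r = ennreal (exp (- \<omega> * r) * r)" for r
  have [measurable]: "w \<in> borel_measurable borel"
    unfolding w_def by measurable
  have V_eq: "?V = (\<integral>\<^sup>+r\<in>{0<..<t}. (w r * \<phi>' r) \<partial>lborel)"
    unfolding nn_integral_completion[symmetric, of lborel "\<lambda>r. w r * \<phi>' r * indicator {0<..<t} r"]
  proof (rule nn_integral_cong_AE)
    show "AE s in lebesgue. ennreal (exp (- \<omega> * s) * s * p (D s)) * indicator {0<..<t} s =
        w s * \<phi>' s * indicator {0<..<t} s"
      using AE_completion[OF \<phi>'] AE_not_in[OF N]
    proof eventually_elim
      case (elim s)
      show ?case
      proof (cases "s \<in> {0<..<t}")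
        case True
        then have "\<phi>' s = ennreal (p (D s))"
          using elim t by (auto simp: \<phi>_def)
        then show ?thesis
          using True by (simp add: w_def ennreal_mult seminorm_nonneg[OF p])
      qed simp
    qed
  qed
  have incr: "ennreal (p (f y - f x)) \<le> (\<integral>\<^sup>+r\<in>{x..y}. \<phi>' r \<partial>lborel)"
    if "0 < x" "x \<le> y" "y < T" for x y
    unfolding \<phi>'_int[symmetric]
  proof (rule absolutely_continuous_increment_le_nn_integral[OF p _ \<open>x \<le> y\<close> N _ _ \<phi>])
    show "absolutely_continuous_on_interval p x y f"
      using lac that by (simp add: locally_absolutely_continuous_def)
  qed (use deriv \<phi>_eq that in auto)
  define M where "M \<xi> = (\<integral>\<^sup>+r\<in>{0<..<(1 + \<xi>) * t}. (w r * \<phi>' r) \<partial>lborel)" for \<xi>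
  have "Limsup (at_right 0) M \<le> ?V"
    unfolding Limsup_le_iff
  proof (intro allI impI)
    \<comment> \<open>If \<open>?V\<close> is infinite there is no such \<open>y\<close>; otherwise
      the gap z' - v is the room available for the overhang past \<open>t\<close>.\<close>
    fix y assume "y > ?V"
    then obtain z where z: "?V < z" "z < y"
      using dense by blast
    obtain v where v: "?V = ennreal v" "0 \<le> v"
      using z(1) by (cases ?V) auto
    obtain z' where z': "z = ennreal z'" "0 \<le> z'"
      using z(2) by (cases z) auto
    have "v < z'"
      using z(1) v z' by (simp add: ennreal_less_iff)
    \<comment> \<open>Bounds the weight \<open>w\<close> on (0, T): an unweighted overhang of at
      most (z' - v) / C then contributes at most z' - v.\<close>
    define C where "C = exp (\<bar>\<omega>\<bar> * T) * T"
    have C: "0 < C"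
      using t by (simp add: C_def)
    have w_le: "w r \<le> ennreal C" if "0 < r" "r < T" for r
      unfolding w_def C_def
    proof (intro ennreal_leI mult_mono)
      have "- \<omega> * r \<le> \<bar>\<omega>\<bar> * r"
        using that by (intro mult_right_mono) auto
      also have "\<dots> \<le> \<bar>\<omega>\<bar> * T"
        using that by (intro mult_left_mono) auto
      finally show "exp (- \<omega> * r) \<le> exp (\<bar>\<omega>\<bar> * T)"
        by simp
    qed (use that in auto)
    have "(z' - v) / C > 0"
      using C \<open>v < z'\<close> by simp
    from locally_absolutely_continuous_nn_integral_small[OF p lac t this N deriv \<phi>_eq \<phi>]
    obtain b where b: "t < b" "b < T" "(\<integral>\<^sup>+r\<in>{t..b}. \<phi>' r \<partial>lborel) \<le> ennreal ((z' - v) / C)"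
      unfolding \<phi>'_int by blast
    have "((\<lambda>\<xi>. (1 + \<xi>) * t) \<longlongrightarrow> (1 + 0) * t) (at_right 0)"
      by (intro tendsto_intros)
    then have "\<forall>\<^sub>F \<xi> in at_right 0. (1 + \<xi>) * t < b"
      using b(1) by (intro order_tendstoD(2)) auto
    then show "\<forall>\<^sub>F \<xi> in at_right 0. M \<xi> < y"
    proof eventually_elim
      case (elim \<xi>)
      have "M \<xi> \<le> (\<integral>\<^sup>+r. (w r * \<phi>' r * indicator {0<..<t} r + ennreal C * (\<phi>' r * indicator {t..b} r)) \<partial>lborel)"
        unfolding M_def
      proof (rule nn_integral_mono)
        fix r :: real
        consider "r \<in> {0<..<t}" | "r \<in> {t..b}" | "r \<notin> {0<..<(1 + \<xi>) * t}"
          using elim by force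
        then show "w r * \<phi>' r * indicator {0<..<(1 + \<xi>) * t} r
            \<le> w r * \<phi>' r * indicator {0<..<t} r + ennreal C * (\<phi>' r * indicator {t..b} r)"
        proof cases
          case 2
          then show ?thesis
            using w_le[of r] t b by (auto simp: indicator_def intro!: mult_right_mono)
        qed (auto simp: indicator_def)
      qed
      also have "\<dots> = ?V + ennreal C * (\<integral>\<^sup>+r\<in>{t..b}. \<phi>' r \<partial>lborel)"
        unfolding V_eq by (subst nn_integral_add) (auto simp: nn_integral_cmult)
      also have "\<dots> \<le> ennreal v + ennreal C * ennreal ((z' - v) / C)"
        unfolding v(1) using b(3) by (intro add_left_mono mult_left_mono) auto
      also have "\<dots> = z"
        using C \<open>v < z'\<close> v(2) z'(1) by (simp flip: ennreal_mult ennreal_plus)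
      finally show "M \<xi> < y"
        using z(2) by (rule le_less_trans)
    qed
  qed
  moreover have "((\<lambda>\<xi>. exp (\<bar>\<omega>\<bar> * T * \<xi>)) \<longlongrightarrow> 1) (at_right (0::real))"
    by (auto intro!: tendsto_eq_intros)
  ultimately have "Limsup (at_right 0) (\<lambda>\<xi>. ennreal (exp (\<bar>\<omega>\<bar> * T * \<xi>)) * M \<xi>) \<le> ?V"
    by (rule Limsup_at_right_mult_le)
  moreover have "Limsup (at_right 0) ?Q \<le> Limsup (at_right 0) (\<lambda>\<xi>. ennreal (exp (\<bar>\<omega>\<bar> * T * \<xi>)) * M \<xi>)"
  proof (rule Limsup_mono)
    \<comment> \<open>For small \<xi> the points s + \<xi> s with s < t stay in (0, T), where the
      increment bound holds.\<close>
    have "((\<lambda>\<xi>. (1 + \<xi>) * t) \<longlongrightarrow> (1 + 0) * t) (at_right 0)"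
      by (intro tendsto_intros)
    then have "\<forall>\<^sub>F \<xi> in at_right 0. (1 + \<xi>) * t < T"
      using t by (intro order_tendstoD(2)) auto
    then show "\<forall>\<^sub>F \<xi> in at_right 0. ?Q \<xi> \<le> ennreal (exp (\<bar>\<omega>\<bar> * T * \<xi>)) * M \<xi>"
      using eventually_at_right_less[of "0::real"]
    proof eventually_elim
      case (elim \<xi>)
      have "?Q \<xi> = (\<integral>\<^sup>+s\<in>{0<..<t}. ennreal (exp (- \<omega> * s) * p ((f (s + \<xi> * s) - f s) /\<^sub>R \<xi>)) \<partial>lborel)"
        by (rule nn_integral_completion)
      also have "\<dots> \<le> (\<integral>\<^sup>+s\<in>{0<..<t}. (ennreal (exp (- \<omega> * s) / \<xi>) * (\<integral>\<^sup>+r\<in>{s..s + \<xi> * s}. \<phi>' r \<partial>lborel)) \<partial>lborel)"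
      proof (rule nn_integral_mono)
        fix s :: real
        show "ennreal (exp (- \<omega> * s) * p ((f (s + \<xi> * s) - f s) /\<^sub>R \<xi>)) * indicator {0<..<t} s
          \<le> ennreal (exp (- \<omega> * s) / \<xi>) * (\<integral>\<^sup>+r\<in>{s..s + \<xi> * s}. \<phi>' r \<partial>lborel) * indicator {0<..<t} s"
        proof (cases "s \<in> {0<..<t}")
          case True
          have "(1 + \<xi>) * s \<le> (1 + \<xi>) * t"
            using True elim by (intro mult_left_mono) auto
          then have "s + \<xi> * s < T"
            using elim by (simp add: algebra_simps)
          moreover have "s \<le> s + \<xi> * s"
            using True elim by simp
          ultimately have le: "ennreal (p (f (s + \<xi> * s) - f s)) \<le> (\<integral>\<^sup>+r\<in>{s..s + \<xi> * s}. \<phi>' r \<partial>lborel)"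
            using True by (intro incr) auto
          have "exp (- \<omega> * s) * p ((f (s + \<xi> * s) - f s) /\<^sub>R \<xi>)
              = exp (- \<omega> * s) / \<xi> * p (f (s + \<xi> * s) - f s)"
            using elim by (simp add: seminorm_scaleR[OF p] divide_inverse)
          then have "ennreal (exp (- \<omega> * s) * p ((f (s + \<xi> * s) - f s) /\<^sub>R \<xi>))
              = ennreal (exp (- \<omega> * s) / \<xi>) * ennreal (p (f (s + \<xi> * s) - f s))"
            using elim by (simp add: ennreal_mult seminorm_nonneg[OF p] del: times_divide_eq_left)
          then show ?thesis
            using True mult_left_mono[OF le] by simp
        qed simp
      qed
      also have "\<dots> \<le> ennreal (exp (\<bar>\<omega>\<bar> * T * \<xi>)) * M \<xi>"
        unfolding M_def w_def using t elim by (intro nn_integral_scaled_average_le) auto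
      finally show ?case .
    qed
  qed
  ultimately show ?thesis
    by (rule order_trans[rotated])
qed

section \<open>Rescaled inputs\<close>

text \<open>Almost everywhere p (f x) is the limit of p (s n x); completeness of Lebesgue measure
  tolerates the exceptional null set.\<close>

lemma strongly_measurable_imp_seminorm_measurable:
  assumes p: "is_seminorm p" and f: "strongly_measurable p lebesgue f"
  shows "(\<lambda>x. p (f x)) \<in> borel_measurable lebesgue"
proof -
  obtain s where s: "\<And>n::nat. simple_function lebesgue (s n)"
    "AE x in lebesgue. (\<lambda>n. p (s n x - f x)) \<longlonglongrightarrow> 0"
    using f unfolding strongly_measurable_def by blast
  have "(\<lambda>x. p (s n x)) \<in> borel_measurable lebesgue" for n
    by (rule borel_measurable_simple_function) (rule simple_function_compose1[OF s(1)])
  then have "(\<lambda>x. lim (\<lambda>n. p (s n x))) \<in> borel_measurable lebesgue"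
    by (rule borel_measurable_lim_metric)
  moreover have "AE x in lebesgue. lim (\<lambda>n. p (s n x)) = p (f x)"
    using s(2)
  proof eventually_elim
    case (elim x)
    show ?case
      by (rule limI[OF seminorm_tendsto[OF p elim]])
  qed
  ultimately show ?thesis
    by (rule borel_measurable_AE)
qed

text \<open>Scaling does not map (0, T) onto itself, so inputs are extended to the line, scaled
  there and restricted again.\<close>

lemma strongly_measurable_zero_ext:
  assumes p: "is_seminorm p" and f: "strongly_measurable p (lebesgue_on {0<..<T}) f"
  shows "strongly_measurable p lebesgue (zero_ext T f)"
proof -
  obtain s where s: "\<And>n::nat. simple_function (lebesgue_on {0<..<T}) (s n)"
    "AE x in lebesgue_on {0<..<T}. (\<lambda>n. p (s n x - f x)) \<longlonglongrightarrow> 0"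
    using f unfolding strongly_measurable_def by blast
  have "simple_function lebesgue (zero_ext T (s n))" for n
    unfolding simple_function_def
  proof (intro conjI ballI)
    have fin: "finite (s n ` {0<..<T})"
      using simple_functionD(1)[OF s(1)] by simp
    have "zero_ext T (s n) ` space lebesgue \<subseteq> insert 0 (s n ` {0<..<T})"
      by (auto simp: zero_ext_def)
    then show "finite (zero_ext T (s n) ` space lebesgue)"
      by (rule finite_subset) (simp add: fin)
    fix y
    have "s n -` {y} \<inter> {0<..<T} \<in> sets (lebesgue_on {0<..<T})"
      using simple_functionD(2)[OF s(1), of n "{y}"] by simp
    then have "s n -` {y} \<inter> {0<..<T} \<in> sets lebesgue"
      by (subst (asm) sets_restrict_space_iff) auto
    moreover have "zero_ext T (s n) -` {y} \<inter> space lebesgue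
        = (s n -` {y} \<inter> {0<..<T}) \<union> (if y = 0 then - {0<..<T} else {})"
      by (auto simp: zero_ext_def split: if_splits)
    ultimately show "zero_ext T (s n) -` {y} \<inter> space lebesgue \<in> sets lebesgue"
      by (auto intro!: sets.Un)
  qed
  moreover have "AE x in lebesgue. (\<lambda>n. p (zero_ext T (s n) x - zero_ext T f x)) \<longlonglongrightarrow> 0"
    using s(2) by (subst (asm) AE_restrict_space_iff)
      (auto simp: zero_ext_def seminorm_zero[OF p] elim: eventually_mono)
  ultimately show ?thesis
    unfolding strongly_measurable_def by (intro exI[of _ "\<lambda>n. zero_ext T (s n)"] conjI allI)
qed

text \<open>The exceptional set stays null because Lebesgue measure is \<open>\<bar>c\<bar>\<close>
  times its own image under the scaling, and a positive constant density has the same null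
  sets.\<close>

lemma strongly_measurable_scale:
  fixes c :: real
  assumes f: "strongly_measurable p lebesgue f" and c: "c \<noteq> 0"
  shows "strongly_measurable p lebesgue (\<lambda>x. f (c * x))"
proof -
  obtain s where s: "\<And>n::nat. simple_function lebesgue (s n)"
    "AE x in lebesgue. (\<lambda>n. p (s n x - f x)) \<longlonglongrightarrow> 0"
    using f unfolding strongly_measurable_def by blast
  have scale: "(\<lambda>x::real. c * x) \<in> lebesgue \<rightarrow>\<^sub>M lebesgue"
  proof -
    have "(\<lambda>x. c * x) = (*\<^sub>R) c"
      by (simp add: fun_eq_iff)
    then show ?thesis
      by (simp only: lebesgue_measurable_scaling)
  qed
  have "simple_function lebesgue (\<lambda>x. s n (c * x))" for n
    by (rule simple_function_comp[OF scale s(1)])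
  moreover have "AE x in lebesgue. (\<lambda>n. p (s n (c * x) - f (c * x))) \<longlonglongrightarrow> 0"
  proof -
    have "AE x in density (distr lebesgue lebesgue (\<lambda>x. 0 + c * x)) (\<lambda>_. ennreal \<bar>c\<bar>).
        (\<lambda>n. p (s n x - f x)) \<longlonglongrightarrow> 0"
      using s(2) unfolding lebesgue_real_affine[OF c, of 0, symmetric] .
    then have "AE x in distr lebesgue lebesgue (\<lambda>x. 0 + c * x). (\<lambda>n. p (s n x - f x)) \<longlonglongrightarrow> 0"
      using c by (subst (asm) AE_density) auto
    then show ?thesis
      using AE_distrD[of "\<lambda>x. 0 + c * x" lebesgue lebesgue] scale by simp
  qed
  ultimately show ?thesis
    unfolding strongly_measurable_def by (intro exI[of _ "\<lambda>n x. s n (c * x)"] conjI allI)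
qed

lemma strongly_measurable_lebesgue_on:
  assumes f: "strongly_measurable p lebesgue f" and A: "A \<in> sets lebesgue"
  shows "strongly_measurable p (lebesgue_on A) f"
proof -
  obtain s where s: "\<And>n::nat. simple_function lebesgue (s n)"
    "AE x in lebesgue. (\<lambda>n. p (s n x - f x)) \<longlonglongrightarrow> 0"
    using f unfolding strongly_measurable_def by blast
  have "id \<in> lebesgue_on A \<rightarrow>\<^sub>M lebesgue"
    by (simp add: measurable_restrict_space1 measurable_id id_def)
  then have "simple_function (lebesgue_on A) (s n)" for n
    using simple_function_comp[of id "lebesgue_on A" lebesgue "s n"] s(1) by simp
  moreover have "AE x in lebesgue_on A. (\<lambda>n. p (s n x - f x)) \<longlonglongrightarrow> 0"
    using s(2) A by (subst AE_restrict_space_iff) (auto elim: eventually_mono)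
  ultimately show ?thesis
    unfolding strongly_measurable_def by blast
qed

lemma zero_in_L1:
  assumes p: "is_seminorm p"
  shows "(\<lambda>_. 0) \<in> L1 p T"
  unfolding L1_def strongly_measurable_def
  by (auto intro!: exI[of _ "\<lambda>_ _. 0"] simp: seminorm_zero[OF p])

text \<open>Makes the rescaled input of (ii) admissible in (i). On the whole line scaling divides
  the integral by \<open>c\<close>, and restriction to (0, T) can only lower it.\<close>

lemma scaled_in_L1:
  assumes p: "is_seminorm p" and f: "f \<in> L1 p T" and c: "0 < c"
  shows "(\<lambda>s. zero_ext T f (c * s)) \<in> L1 p T"
  unfolding L1_def mem_Collect_eq
proof
  have meas: "strongly_measurable p lebesgue (zero_ext T f)"
    using f by (intro strongly_measurable_zero_ext p) (simp add: L1_def)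
  then show "strongly_measurable p (lebesgue_on {0<..<T}) (\<lambda>s. zero_ext T f (c * s))"
    using c by (intro strongly_measurable_lebesgue_on strongly_measurable_scale) auto
  have "(\<integral>\<^sup>+x. ennreal (p (zero_ext T f x)) \<partial>lebesgue) = (\<integral>\<^sup>+x. ennreal (p (f x)) \<partial>(lebesgue_on {0<..<T}))"
    by (subst nn_integral_restrict_space)
       (auto intro!: nn_integral_cong simp: zero_ext_def indicator_def seminorm_zero[OF p])
  also have "\<dots> < \<infinity>"
    using f by (simp add: L1_def)
  finally have "ennreal \<bar>c\<bar> * (\<integral>\<^sup>+x. ennreal (p (zero_ext T f (0 + c * x))) \<partial>lebesgue) < \<infinity>"
    using c strongly_measurable_imp_seminorm_measurable[OF p meas]
    by (subst (asm) nn_integral_real_affine_lebesgue[of _ c 0]) auto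
  then have "(\<integral>\<^sup>+x. ennreal (p (zero_ext T f (c * x))) \<partial>lebesgue) < \<infinity>"
    using c by (auto simp: ennreal_mult_less_top)
  then show "(\<integral>\<^sup>+x. ennreal (p (zero_ext T f (c * x))) \<partial>(lebesgue_on {0<..<T})) < \<infinity>"
    by (rule le_less_trans[rotated])
       (subst nn_integral_restrict_space; auto intro!: nn_integral_mono simp: indicator_def)
qed

section \<open>The increment estimate\<close>

text \<open>A non-integrable function has Bochner integral 0 by convention, so the bound is
  unconditional. It carries the real increment estimate to [0, \<infinity>].\<close>

lemma ennreal_integral_le_nn_integral:
  fixes g :: "'a \<Rightarrow> real"
  assumes "\<And>x. 0 \<le> g x"
  shows "ennreal (integral\<^sup>L M g) \<le> (\<integral>\<^sup>+x. ennreal (g x) \<partial>M)"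
proof (cases "integrable M g")
  case True
  then show ?thesis
    using assms by (simp add: nn_integral_eq_integral)
qed (simp add: not_integrable_integral_eq)

text \<open>The increment estimate produces only \<xi> > 0, while V(f,t) is a two-sided upper
  limit.\<close>

lemma Limsup_le_filter:
  fixes g :: "'a \<Rightarrow> 'b::complete_linorder"
  assumes "F \<le> F'"
  shows "Limsup F g \<le> Limsup F' g"
  unfolding Limsup_le_iff using assms by (auto simp: le_filter_def dest: Limsup_lessD)

theorem theorem2p3:
  fixes p :: "'a::real_vector \<Rightarrow> real"
    and T \<omega> L :: real
    and C :: "'a set"
    and S :: "real \<Rightarrow> 'a \<Rightarrow> (real \<Rightarrow> 'a) \<Rightarrow> 'a"
  assumes seminorm: "is_seminorm p"
    and T_pos: "0 < T"
    and L_ge_1: "1 \<le> L"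
    and zero_in_C: "0 \<in> C"
    and C_scale: "\<And>u c. u \<in> C \<Longrightarrow> 0 < c \<Longrightarrow> inverse c *\<^sub>R u \<in> C"
    and S_in_C: "\<And>t u f. t \<in> {0..T} \<Longrightarrow> u \<in> C \<Longrightarrow> f \<in> L1 p T \<Longrightarrow> S t u f \<in> C"
    and S_AE_cong: "\<And>t u f g. t \<in> {0..T} \<Longrightarrow> u \<in> C \<Longrightarrow> f \<in> L1 p T \<Longrightarrow> g \<in> L1 p T \<Longrightarrow>
          (AE s in lebesgue_on {0<..<T}. f s = g s) \<Longrightarrow> S t u f = S t u g"
    and S_0: "\<And>u f. u \<in> C \<Longrightarrow> f \<in> L1 p T \<Longrightarrow> S 0 u f = u"
    and hyp_i: "\<And>s t u v f g. 0 \<le> s \<Longrightarrow> s \<le> t \<Longrightarrow> t \<le> T \<Longrightarrow> u \<in> C \<Longrightarrow> v \<in> C \<Longrightarrow>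
          f \<in> L1 p T \<Longrightarrow> g \<in> L1 p T \<Longrightarrow>
          exp (- \<omega> * t) * p (S t u f - S t v g)
            \<le> L * exp (- \<omega> * s) * p (S s u f - S s v g)
              + L * (LINT r:{s<..<t}|lebesgue. exp (- \<omega> * r) * p (f r - g r))"
    and hyp_ii: "\<And>u f c t. u \<in> C \<Longrightarrow> f \<in> L1 p T \<Longrightarrow> 0 < c \<Longrightarrow> t \<in> {0..T} \<Longrightarrow> c * t \<le> T \<Longrightarrow>
          inverse c *\<^sub>R S (c * t) u f = S t (inverse c *\<^sub>R u) (\<lambda>s. zero_ext T f (c * s))"
    and hyp_iii: "\<And>t. t \<in> {0..T} \<Longrightarrow> S t 0 (\<lambda>_. 0) = 0"
  shows
    "(\<forall>u\<in>C. \<forall>f\<in>L1 p T. \<forall>t h. 0 < t \<and> t \<le> T \<and> 0 < h \<and> t + h \<le> T \<longrightarrow>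
        p (S (t + h) u f - S t u f)
          \<le> h / t * L * exp (\<omega> * t) *
             (2 * p u
              + (1 + h / t) * (LINT s:{0<..<t}|lebesgue.
                    exp (- \<omega> * s) * p ((f (s + h / t * s) - f s) /\<^sub>R (h / t)))
              + (LINT s:{0<..<t}|lebesgue. exp (- \<omega> * s) * p (f s))))
     \<and>
     (\<forall>u\<in>C. \<forall>f\<in>L1 p T. \<forall>t. 0 < t \<and> t < T \<longrightarrow>
        Limsup (at_right 0) (\<lambda>h. ennreal (p ((S (t + h) u f - S t u f) /\<^sub>R h)))
          \<le> ennreal (L * exp (\<omega> * t) / t) *
             (ennreal (2 * p u)
              + variation_limsup p \<omega> f t
              + (\<integral>\<^sup>+s\<in>{0<..<t}. ennreal (exp (- \<omega> * s) * p (f s)) \<partial>lebesgue)))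
     \<and>
     (\<forall>u\<in>C. \<forall>f\<in>L1 p T. \<forall>f'. \<forall>t. 0 < t \<and> t < T \<and>
        locally_absolutely_continuous p T f \<and>
        (AE s in lebesgue_on {0<..<T}. has_seminorm_derivative p f (f' s) s (at 0)) \<longrightarrow>
        Limsup (at_right 0) (\<lambda>h. ennreal (p ((S (t + h) u f - S t u f) /\<^sub>R h)))
          \<le> ennreal (L * exp (\<omega> * t) / t) *
             (ennreal (2 * p u)
              + (\<integral>\<^sup>+s\<in>{0<..<t}. ennreal (exp (- \<omega> * s) * s * p (f' s)) \<partial>lebesgue)
              + (\<integral>\<^sup>+s\<in>{0<..<t}. ennreal (exp (- \<omega> * s) * p (f s)) \<partial>lebesgue)))
     \<and>
     (\<forall>u\<in>C. \<forall>f\<in>L1 p T. \<forall>t D. 0 < t \<and> t < T \<and>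
        has_seminorm_derivative p (\<lambda>\<tau>. S \<tau> u f) D t (at_right 0) \<longrightarrow>
        ennreal (p D)
          \<le> ennreal (L * exp (\<omega> * t) / t) *
             (ennreal (2 * p u)
              + variation_limsup p \<omega> f t
              + (\<integral>\<^sup>+s\<in>{0<..<t}. ennreal (exp (- \<omega> * s) * p (f s)) \<partial>lebesgue)))"
proof -
  note p_nonneg = seminorm_nonneg[OF seminorm]
  note p_scaleR = seminorm_scaleR[OF seminorm]
  have zero_L1: "(\<lambda>_. 0) \<in> L1 p T"
    by (rule zero_in_L1[OF seminorm])
  let ?E = "\<lambda>f \<xi> s. exp (- \<omega> * s) * p ((f (s + \<xi> * s) - f s) /\<^sub>R \<xi>)"
  have increment: "p (S (t + h) u f - S t u f)
          \<le> h / t * L * exp (\<omega> * t) *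
             (2 * p u + (1 + h / t) * (LINT s:{0<..<t}|lebesgue. ?E f (h / t) s)
              + (LINT s:{0<..<t}|lebesgue. exp (- \<omega> * s) * p (f s)))"
    if u: "u \<in> C" and f: "f \<in> L1 p T" and t: "0 < t" "t \<le> T" and h: "0 < h" "t + h \<le> T" for u f t h
  proof -
    define a where "a = h / t"
    define c where "c = 1 + a"
    have a: "0 < a" and ct: "c * t = t + h"
      using t h by (simp_all add: a_def c_def algebra_simps)
    have c: "0 < c"
      using a by (simp add: c_def)
    define g where "g = (\<lambda>s. zero_ext T f (c * s))"
    have g: "g \<in> L1 p T"
      unfolding g_def by (rule scaled_in_L1[OF seminorm f c])
    define u' where "u' = inverse c *\<^sub>R u"
    have u': "u' \<in> C"
      unfolding u'_def by (rule C_scale[OF u c])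
    have scaled: "inverse c *\<^sub>R S (t + h) u f = S t u' g"
      using hyp_ii[OF u f c, of t] t h ct by (simp add: g_def u'_def)
    let ?I = "LINT s:{0<..<t}|lebesgue. ?E f a s"
    let ?J = "LINT s:{0<..<t}|lebesgue. exp (- \<omega> * s) * p (f s)"
    have "exp (- \<omega> * r) * p (g r - f r) = a * ?E f a r" if "r \<in> {0<..<t}" for r
    proof -
      \<comment> \<open>On (0, t) the zero extension does not interfere, as c r < c t = t + h \<le>
        T.\<close>
      have "0 < c * r" "c * r < T"
        using that c mult_strict_left_mono[of r t c] ct h by auto
      then have "g r = f (r + a * r)"
        by (simp add: g_def zero_ext_def c_def algebra_simps)
      then show ?thesis
        using a by (simp add: p_scaleR)
    qed
    then have "(LINT r:{0<..<t}|lebesgue. exp (- \<omega> * r) * p (g r - f r))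
        = (LINT r:{0<..<t}|lebesgue. a * ?E f a r)"
      by (intro set_lebesgue_integral_cong) auto
    also have "\<dots> = a * ?I"
      by simp
    finally have "exp (- \<omega> * t) * p (S t u' g - S t u f) \<le> L * p (u' - u) + L * (a * ?I)"
      using hyp_i[of 0 t u' u g f] u u' f g t by (simp add: S_0)
    then have step1: "p (S t u' g - S t u f) \<le> exp (\<omega> * t) * (L * p (u' - u) + L * (a * ?I))"
      by (simp add: exp_minus field_simps)
    \<comment> \<open>Hypothesis (i) against zero data, whose trajectory stays at 0 by
      (iii).\<close>
    have "exp (- \<omega> * t) * p (S t u f) \<le> L * p u + L * ?J"
      using hyp_i[of 0 t u 0 f "\<lambda>_. 0"] u f t zero_in_C zero_L1 by (simp add: S_0 hyp_iii)
    then have step2: "p (S t u f) \<le> exp (\<omega> * t) * (L * p u + L * ?J)"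
      by (simp add: exp_minus field_simps)
    have "u' - u = (inverse c - 1) *\<^sub>R u"
      by (simp add: u'_def scaleR_left_diff_distrib)
    \<comment> \<open>Since c (u' - u) = - a u, this term costs exactly a p u and merges with the a
      p u coming from \<open>step2\<close> into 2 p u.\<close>
    then have "c * p (u' - u) = \<bar>c * (inverse c - 1)\<bar> * p u"
      using c by (simp only: p_scaleR abs_mult abs_of_pos mult.assoc)
    also have "c * (inverse c - 1) = - a"
      using c by (simp add: right_diff_distrib) (simp add: c_def)
    finally have u'_diff: "c * p (u' - u) = a * p u"
      using a by simp
    have "c *\<^sub>R S t u' g = S (t + h) u f"
      using c by (simp flip: scaled)
    then have "S (t + h) u f - S t u f = c *\<^sub>R (S t u' g - S t u f) + a *\<^sub>R S t u f"
      by (simp add: scaleR_diff_right) (simp add: c_def scaleR_left_distrib)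
    then have "p (S (t + h) u f - S t u f) \<le> c * p (S t u' g - S t u f) + a * p (S t u f)"
      using seminorm_triangle[OF seminorm, of "c *\<^sub>R (S t u' g - S t u f)" "a *\<^sub>R S t u f"] a c
      by (simp add: p_scaleR)
    also have "\<dots> \<le> c * (exp (\<omega> * t) * (L * p (u' - u) + L * (a * ?I)))
        + a * (exp (\<omega> * t) * (L * p u + L * ?J))"
      using a c step1 step2 by (intro add_mono mult_left_mono) auto
    also have "\<dots> = exp (\<omega> * t) * (L * (c * p (u' - u)) + L * (c * (a * ?I)) + a * (L * p u + L * ?J))"
      by (simp add: algebra_simps)
    also have "\<dots> = a * L * exp (\<omega> * t) * (2 * p u + c * ?I + ?J)"
      unfolding u'_diff by (simp add: algebra_simps)
    finally show ?thesis
      by (simp only: a_def c_def)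
  qed
  \<comment> \<open>\<open>V\<close> is left free so that both V(f,t) and the integral of the
    weighted derivative can be substituted for it.\<close>
  have limsup: "Limsup (at_right 0) (\<lambda>h. ennreal (p ((S (t + h) u f - S t u f) /\<^sub>R h)))
          \<le> ennreal (L * exp (\<omega> * t) / t) *
             (ennreal (2 * p u) + V + (\<integral>\<^sup>+s\<in>{0<..<t}. ennreal (exp (- \<omega> * s) * p (f s)) \<partial>lebesgue))"
    if u: "u \<in> C" and f: "f \<in> L1 p T" and t: "0 < t" "t < T"
      and V: "Limsup (at_right 0) (\<lambda>\<xi>. \<integral>\<^sup>+s\<in>{0<..<t}. ennreal (?E f \<xi> s) \<partial>lebesgue) \<le> V" for u f t V
  proof -
    define N where "N \<xi> = (\<integral>\<^sup>+s\<in>{0<..<t}. ennreal (?E f \<xi> s) \<partial>lebesgue)" for \<xi>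
    define J where "J = (\<integral>\<^sup>+s\<in>{0<..<t}. ennreal (exp (- \<omega> * s) * p (f s)) \<partial>lebesgue)"
    \<comment> \<open>A continuous increasing map of [0, \<infinity>] commutes with upper limits;
      the finite prefactor keeps it continuous at \<infinity>.\<close>
    define G where "G x = ennreal (L * exp (\<omega> * t) / t) * (ennreal (2 * p u) + x + J)" for x
    have LINT_nonneg: "0 \<le> (LINT s:{0<..<t}|lebesgue. k s)" if "\<And>s. 0 \<le> k s" for k :: "real \<Rightarrow> real"
      unfolding set_lebesgue_integral_def using that by (intro Bochner_Integration.integral_nonneg) simp
    have LINT_le: "ennreal (LINT s:{0<..<t}|lebesgue. k s) \<le> (\<integral>\<^sup>+s\<in>{0<..<t}. ennreal (k s) \<partial>lebesgue)"
      if "\<And>s. 0 \<le> k s" for k :: "real \<Rightarrow> real"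
    proof -
      have "(\<integral>\<^sup>+s. ennreal (indicator {0<..<t} s *\<^sub>R k s) \<partial>lebesgue)
          = (\<integral>\<^sup>+s\<in>{0<..<t}. ennreal (k s) \<partial>lebesgue)"
        by (intro nn_integral_cong) (simp add: indicator_def)
      then show ?thesis
        using ennreal_integral_le_nn_integral[of "\<lambda>s. indicator {0<..<t} s *\<^sub>R k s" lebesgue] that
        by (simp add: set_lebesgue_integral_def)
    qed
    have "((\<lambda>\<xi>. 1 + \<xi>) \<longlongrightarrow> 1) (at_right (0::real))"
      by (auto intro!: tendsto_eq_intros)
    with V have "Limsup (at_right 0) (\<lambda>\<xi>. ennreal (1 + \<xi>) * N \<xi>) \<le> V"
      unfolding N_def by (rule Limsup_at_right_mult_le)
    then have V': "Limsup (at_right 0) (\<lambda>h. ennreal (1 + h / t) * N (h / t)) \<le> V"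
      using Limsup_at_right_rescale[OF t(1), of "\<lambda>\<xi>. ennreal (1 + \<xi>) * N \<xi>"] by (rule order_trans[rotated])
    have "mono G"
      unfolding G_def by (intro monoI mult_left_mono add_mono) auto
    have "continuous_on UNIV G"
      unfolding G_def by (intro ennreal_continuous_on_cmult continuous_on_add_ennreal continuous_intros) auto
    have "Limsup (at_right 0) (\<lambda>h. ennreal (p ((S (t + h) u f - S t u f) /\<^sub>R h)))
        \<le> Limsup (at_right 0) (\<lambda>h. G (ennreal (1 + h / t) * N (h / t)))"
    proof (rule Limsup_mono)
      have "\<forall>\<^sub>F h in at_right 0. h < T - t"
        using t by (intro order_tendstoD(2)[OF tendsto_ident_at]) auto
      then show "\<forall>\<^sub>F h in at_right 0. ennreal (p ((S (t + h) u f - S t u f) /\<^sub>R h))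
          \<le> G (ennreal (1 + h / t) * N (h / t))"
        using eventually_at_right_less[of "0::real"]
      proof eventually_elim
        case (elim h)
        let ?I = "LINT s:{0<..<t}|lebesgue. ?E f (h / t) s"
        let ?J = "LINT s:{0<..<t}|lebesgue. exp (- \<omega> * s) * p (f s)"
        have I: "0 \<le> ?I" "ennreal ?I \<le> N (h / t)" and J: "0 \<le> ?J" "ennreal ?J \<le> J"
          unfolding N_def J_def
          by (intro LINT_le LINT_nonneg mult_nonneg_nonneg exp_ge_zero p_nonneg)+
        have "p ((S (t + h) u f - S t u f) /\<^sub>R h) = p (S (t + h) u f - S t u f) / h"
          using elim by (simp add: p_scaleR divide_inverse mult.commute)
        also have "\<dots> \<le> h / t * L * exp (\<omega> * t) * (2 * p u + (1 + h / t) * ?I + ?J) / h"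
          using elim t by (intro divide_right_mono increment u f) auto
        also have "\<dots> = L * exp (\<omega> * t) / t * (2 * p u + (1 + h / t) * ?I + ?J)"
          using elim by simp
        finally have "ennreal (p ((S (t + h) u f - S t u f) /\<^sub>R h))
            \<le> ennreal (L * exp (\<omega> * t) / t * (2 * p u + (1 + h / t) * ?I + ?J))"
          by (rule ennreal_leI)
        also have "\<dots> = ennreal (L * exp (\<omega> * t) / t) *
            (ennreal (2 * p u) + ennreal (1 + h / t) * ennreal ?I + ennreal ?J)"
        proof -
          have "0 \<le> L * exp (\<omega> * t) / t" "0 \<le> 2 * p u" "0 \<le> 1 + h / t"
            using L_ge_1 t elim p_nonneg by auto
          then show ?thesis
            using I(1) J(1) by (simp only: ennreal_mult ennreal_plus add_nonneg_nonneg mult_nonneg_nonneg)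
        qed
        also have "\<dots> \<le> G (ennreal (1 + h / t) * N (h / t))"
          unfolding G_def using I(2) J(2) by (intro mult_left_mono add_mono) auto
        finally show ?case .
      qed
    qed
    also have "\<dots> = G (Limsup (at_right 0) (\<lambda>h. ennreal (1 + h / t) * N (h / t)))"
      using \<open>continuous_on UNIV G\<close> \<open>mono G\<close> by (rule Limsup_compose_continuous_mono) simp
    also have "\<dots> \<le> G V"
      using \<open>mono G\<close> V' by (rule monoD)
    finally show ?thesis
      by (simp only: G_def J_def)
  qed
  have limsup_V: "Limsup (at_right 0) (\<lambda>h. ennreal (p ((S (t + h) u f - S t u f) /\<^sub>R h)))
          \<le> ennreal (L * exp (\<omega> * t) / t) *
             (ennreal (2 * p u) + variation_limsup p \<omega> f t
              + (\<integral>\<^sup>+s\<in>{0<..<t}. ennreal (exp (- \<omega> * s) * p (f s)) \<partial>lebesgue))"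
    if "u \<in> C" "f \<in> L1 p T" "0 < t" "t < T" for u f t
    unfolding variation_limsup_def
    by (rule limsup[OF that]) (rule Limsup_le_filter[OF at_le[OF subset_UNIV]])
  have derivative: "ennreal (p D)
          \<le> ennreal (L * exp (\<omega> * t) / t) *
             (ennreal (2 * p u) + variation_limsup p \<omega> f t
              + (\<integral>\<^sup>+s\<in>{0<..<t}. ennreal (exp (- \<omega> * s) * p (f s)) \<partial>lebesgue))"
    if "u \<in> C" "f \<in> L1 p T" "0 < t" "t < T"
      and D: "has_seminorm_derivative p (\<lambda>\<tau>. S \<tau> u f) D t (at_right 0)" for u f t D
  proof -
    \<comment> \<open>\<open>D\<close> is determined only up to vectors of seminorm 0, but p D is a
      true limit and hence equals the upper limit.\<close>
    have "((\<lambda>h. ennreal (p ((S (t + h) u f - S t u f) /\<^sub>R h))) \<longlongrightarrow> ennreal (p D)) (at_right 0)"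
      using D unfolding has_seminorm_derivative_def
      by (intro tendsto_ennrealI seminorm_tendsto[OF seminorm])
    then have "Limsup (at_right 0) (\<lambda>h. ennreal (p ((S (t + h) u f - S t u f) /\<^sub>R h))) = ennreal (p D)"
      by (intro lim_imp_Limsup) simp_all
    then show ?thesis
      using limsup_V[OF that(1-4)] by simp
  qed
  show ?thesis
    using increment limsup_V derivative
      limsup[OF _ _ _ _ derivative_quotient_Limsup_le[OF seminorm]] by blast
qed

end
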